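(* Let $\ell\in\mathbb N$, let $(G,+)$ be a countable abelian group and let $(X,\mathcal A,\mu,(T_g)_{g\in G})$ be a measure preserving system. The following statements are equivalent: (i) $(T_g)_{g\in G}$ is strongly mixing. (ii) For any $\ell$ non-degenerated and essentially distinct sequences $(\mathbf g^{(j)}_k)_{k\in\mathbb N}=(g^{(j)}_{k,1},\dots,g^{(j)}_{k,\ell})_{k\in\mathbb N}$, $j\in\{1,\dots,\ell\}$, in $G^\ell$, there exists an infinite set $S\subseteq\mathbb N$ such that for any $A_0,\dots,A_\ell\in\mathcal A$, $$\mathop{\mathcal R\text{-}\lim}_{\alpha\in S^{(\ell)}}\mu\big(A_0\cap T_{g^{(1)}_\alpha}A_1\cap\cdots\cap T_{g^{(\ell)}_\alpha}A_\ell\big)=\prod_{j=0}^\ell\mu(A_j),$$ where $g^{(j)}_\alpha=g^{(j)}_{k_1,1}+\cdots+g^{(j)}_{k_\ell,\ell}$ for $\alpha=\{k_1<\cdots<k_\ell\}$. (iii) For any $\epsilon>0$ and any $A_0,\dots,A_\ell\in\mathcal A$, the set $$R_\epsilon(A_0,\dots,A_\ell)=\Big\{(g_1,\dots,g_\ell)\in G^\ell : \Big|\mu(A_0\cap T_{g_1}A_1\cap\cdots\cap T_{g_\ell}A_\ell)-\prod_{j=0}^\ell\mu(A_j)\Big|<\epsilon\Big\}$$ is $\tilde\Sigma_\ell^*$ in $G^\ell$. (iv) For any $\epsilon>0$ and any $A_0,A_1\in\mathcal A$, the set $R_\epsilon(A_0,A_1)=\{g\in G : |\mu(A_0\cap T_gA_1)-\mu(A_0)\mu(A_1)|<\epsilon\}$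 is $\Sigma_\ell^*$ in $G$.
   Context: $\mathbb N=\{1,2,\dots\}$. A measure preserving system $(X,\mathcal A,\mu,(T_g)_{g\in G})$ consists of a separable probability space $(X,\mathcal A,\mu)$ and an action $(T_g)_{g\in G}$ of the countable discrete abelian group $G$ on it by (invertible) $\mu$-preserving transformations; as a standing assumption the space is regular, i.e. $X$ is a compact metric space and $\mathcal A=\mathrm{Borel}(X)$. For a sequence in $G$, $\lim_{k\to\infty}g_k=\infty$ means that for every finite $F\subseteq G$, $g_k\notin F$ for all large $k$. The system is strongly mixing if $\lim_{g\to\infty}\mu(A_0\cap T_gA_1)=\mu(A_0)\mu(A_1)$ for all $A_0,A_1\in\mathcal A$. A sequence $(g_{k,1},\dots,g_{k,m})_{k\in\mathbb N}$ in $G^m$ is non-degenerated if $\lim_{k\to\infty}g_{k,t}=\infty$ for each $t\in\{1,\dots,m\}$. Two sequences $(g_{k})_{k\in\mathbb N}$, $(h_k)_{k\in\mathbb N}$ in $G$ grow apart if $\lim_{k\to\infty}(g_k-h_k)=\infty$. Sequences $(g_{k,1},\dots,g_{k,m})_{k\in\mathbb N}$ and $(h_{k,1},\dots,h_{k,m})_{k\in\mathbb N}$ in $G^m$ are essentially distinct if for each $t$, $(g_{k,t})_k$ and $(h_{k,t})_k$ grow apart; several sequences are essentially distinct if any two of them (with distinct indices) are. For infinite $S\subseteq\mathbb N$, $S^{(m)}$ is the family of all $m$-element subsets of $S$. For a family $(x_\alpha)_{\alpha\in\mathbb N^{(m)}}$ in a compact metric space $(Y,d)$, $\mathcal R\text{-}\lim_{\alpha\in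 S^{(m)}}x_\alpha=x$ means: for every $\epsilon>0$ there is $\alpha_0\in\mathbb N^{(m)}$ such that $d(x_\alpha,x)<\epsilon$ for all $\alpha\in S^{(m)}$ with $\min\alpha>\max\alpha_0$. A set $E\subseteq G^d$ is a $\tilde\Sigma_m$ set if $E=\{\mathbf g^{(1)}_{k_1}+\cdots+\mathbf g^{(m)}_{k_m} : k_1<\cdots<k_m\}$ where for each $j\in\{1,\dots,m\}$, $(\mathbf g^{(j)}_k)_{k\in\mathbb N}=(g^{(j)}_{k,1},\dots,g^{(j)}_{k,d})_{k\in\mathbb N}$ is a non-degenerated sequence in $G^d$ and for distinct $t,t'\in\{1,\dots,d\}$ the sequences $(g^{(j)}_{k,t})_k$ and $(g^{(j)}_{k,t'})_k$ grow apart. When $d=1$ these are called $\Sigma_m$ sets. A subset of $G^d$ is $\tilde\Sigma_m^*$ (respectively, for $d=1$, $\Sigma_m^*$) if it has non-empty intersection with every $\tilde\Sigma_m$ (respectively $\Sigma_m$) set in $G^d$. *)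

theory Defs
  imports "HOL-Probability.Probability" "HOL-Library.Ramsey"
begin

(* Sequences over the positive integers are indexed by the type nat, i.e. reindexed by k - 1.
   Coordinates t and the labels j of the several sequences range over {1..n}, as in the source.
   A sequence in G^d is a function g with g k t the t-th coordinate of the k-th term; its values
   at t outside {1..d} are never used. *)

(* Here X = space M is a compact subset of a metric space; separability of the probability space
   follows from regularity. Invertibility of T g follows from the action laws. *)
locale measure_preserving_system = prob_space M
  for M :: "'x::metric_space measure" +
  fixes T :: "'g::{ab_group_add,countable} \<Rightarrow> 'x \<Rightarrow> 'x"
  assumes compact_space: "compact (space M)"
    and sets_borel: "sets M = sets (restrict_space borel (space M))"
    and T_measurable: "\<And>g. T g \<in> measurable M M"
    and T_preserves: "\<And>g. distr M M (T g) = M"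
    and T_zero: "\<And>x. x \<in> space M \<Longrightarrow> T 0 x = x"
    and T_add: "\<And>g h x. x \<in> space M \<Longrightarrow> T (g + h) x = T g (T h x)"

(* g tends to infinity in the discrete group G exactly when it leaves every finite set, i.e.
   along the filter cofinite. *)
definition strongly_mixing :: "'x measure \<Rightarrow> ('g \<Rightarrow> 'x \<Rightarrow> 'x) \<Rightarrow> bool" where
  "strongly_mixing M T \<longleftrightarrow>
     (\<forall>A0\<in>sets M. \<forall>A1\<in>sets M.
        ((\<lambda>g. measure M (A0 \<inter> T g ` A1)) \<longlongrightarrow> measure M A0 * measure M A1) cofinite)"

definition non_degenerated :: "nat \<Rightarrow> (nat \<Rightarrow> nat \<Rightarrow> 'g) \<Rightarrow> bool" where
  "non_degenerated d g \<longleftrightarrow> (\<forall>t\<in>{1..d}. filterlim (\<lambda>k. g k t) cofinite sequentially)"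

definition grow_apart :: "(nat \<Rightarrow> 'g::ab_group_add) \<Rightarrow> (nat \<Rightarrow> 'g) \<Rightarrow> bool" where
  "grow_apart g h \<longleftrightarrow> filterlim (\<lambda>k. g k - h k) cofinite sequentially"

definition essentially_distinct ::
    "nat \<Rightarrow> (nat \<Rightarrow> nat \<Rightarrow> 'g::ab_group_add) \<Rightarrow> (nat \<Rightarrow> nat \<Rightarrow> 'g) \<Rightarrow> bool" where
  "essentially_distinct d g h \<longleftrightarrow> (\<forall>t\<in>{1..d}. grow_apart (\<lambda>k. g k t) (\<lambda>k. h k t))"

definition R_lim :: "nat \<Rightarrow> nat set \<Rightarrow> (nat set \<Rightarrow> 'y::metric_space) \<Rightarrow> 'y \<Rightarrow> bool" where
  "R_lim m S x L \<longleftrightarrow>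
     (\<forall>\<epsilon>>0. \<exists>\<alpha>0\<in>nsets UNIV m. \<forall>\<alpha>\<in>nsets S m. Min \<alpha> > Max \<alpha>0 \<longrightarrow> dist (x \<alpha>) L < \<epsilon>)"

(* The t-th smallest element k_t of alpha is entry t - 1 of its increasing enumeration. *)
definition sum_along :: "nat \<Rightarrow> (nat \<Rightarrow> nat \<Rightarrow> 'g::ab_group_add) \<Rightarrow> nat set \<Rightarrow> 'g" where
  "sum_along m g \<alpha> = (\<Sum>t=1..m. g (sorted_list_of_set \<alpha> ! (t - 1)) t)"

definition group_power :: "nat \<Rightarrow> (nat \<Rightarrow> 'g) set" where
  "group_power d = {1..d} \<rightarrow>\<^sub>E UNIV"

definition tilde_Sigma :: "nat \<Rightarrow> nat \<Rightarrow> (nat \<Rightarrow> 'g::ab_group_add) set \<Rightarrow> bool" where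
  "tilde_Sigma m d E \<longleftrightarrow>
     (\<exists>g :: nat \<Rightarrow> nat \<Rightarrow> nat \<Rightarrow> 'g.
        (\<forall>j\<in>{1..m}. non_degenerated d (g j) \<and>
           (\<forall>t\<in>{1..d}. \<forall>t'\<in>{1..d}. t \<noteq> t' \<longrightarrow> grow_apart (\<lambda>k. g j k t) (\<lambda>k. g j k t'))) \<and>
        E = {\<lambda>t\<in>{1..d}. \<Sum>j=1..m. g j (k j) t | k. strict_mono_on {1..m} k})"

definition tilde_Sigma_star :: "nat \<Rightarrow> nat \<Rightarrow> (nat \<Rightarrow> 'g::ab_group_add) set \<Rightarrow> bool" where
  "tilde_Sigma_star m d D \<longleftrightarrow> D \<subseteq> group_power d \<and> (\<forall>E. tilde_Sigma m d E \<longrightarrow> D \<inter> E \<noteq> {})"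

(* The case d = 1, under the identification of G with G^1. *)
definition Sigma_set :: "nat \<Rightarrow> 'g::ab_group_add set \<Rightarrow> bool" where
  "Sigma_set m E \<longleftrightarrow> tilde_Sigma m 1 ((\<lambda>x. \<lambda>t\<in>{1..1}. x) ` E)"

definition Sigma_star :: "nat \<Rightarrow> 'g::ab_group_add set \<Rightarrow> bool" where
  "Sigma_star m D \<longleftrightarrow> (\<forall>E. Sigma_set m E \<longrightarrow> D \<inter> E \<noteq> {})"

definition R_set ::
    "'x measure \<Rightarrow> ('g \<Rightarrow> 'x \<Rightarrow> 'x) \<Rightarrow> nat \<Rightarrow> real \<Rightarrow> (nat \<Rightarrow> 'x set) \<Rightarrow> (nat \<Rightarrow> 'g) set" where
  "R_set M T l \<epsilon> A =
     {g \<in> group_power l.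
        \<bar>measure M (A 0 \<inter> (\<Inter>j\<in>{1..l}. T (g j) ` A j)) - (\<Prod>j=0..l. measure M (A j))\<bar> < \<epsilon>}"

end

theory Submission
  imports Defs "HOL-Library.Diagonal_Subsequence"
begin

text \<open>
  Two ideas carry all implications: Ramsey's theorem turns "every infinite \<open>S\<close> contains one good
  \<open>m\<close>-element set" into "some infinite \<open>S\<close> contains only good ones", and an elementary form of
  Bessel's inequality (\<open>nearly_independent_events_meet\<close>) says that among many events of equal
  probability which are pairwise nearly independent, at least one is nearly independent of any
  prescribed event.

  \<^emph>\<open>From mixing to correlations of many sets.\<close> Let \<open>g\<^sub>0, \<dots>, g\<^sub>m\<close> be pairwise essentially distinct
  sequences in \<open>G\<^sup>m\<close>. The claim (\<open>mixing_along_sums\<close>) is that \<open>T (g\<^sub>j \<alpha>) ` A\<^sub>j\<close>, \<open>j \<le> m\<close>, are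
  nearly independent for some \<open>\<alpha>\<close>, by induction on \<open>m\<close>. By invariance one may take \<open>g\<^sub>0 = 0\<close>. Split
  \<open>\<alpha> = {k} \<union> \<beta>\<close> with \<open>k < min \<beta>\<close>, so that \<open>g\<^sub>j \<alpha> = a\<^sub>j k + h\<^sub>j \<beta>\<close>, and put
  \<open>H k = (\<Inter>j\<ge>1. T (h\<^sub>j \<beta>) ` T (a\<^sub>j k) ` A\<^sub>j)\<close>. The intersection of \<open>H k\<close> and \<open>H k'\<close> is again a
  correlation along \<open>\<beta>\<close>, now of the sets \<open>T (a\<^sub>j k) ` A\<^sub>j \<inter> T (a\<^sub>j k') ` A\<^sub>j\<close>. It involves only
  \<open>m\<close> sequences in \<open>G\<^bsup>m - 1\<^esup>\<close>, hence is governed by the induction hypothesis, and mixing gives these sets measure close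
  to the square of the measure of \<open>A\<^sub>j\<close> once \<open>k\<close> and \<open>k'\<close> are far apart. So the events \<open>H k\<close> are pairwise nearly
  independent for a suitable \<open>\<beta>\<close>, and Bessel's inequality yields a \<open>k\<close> for which \<open>H k\<close> is nearly
  independent of \<open>A\<^sub>0\<close>. Only finitely many conditions on \<open>\<beta>\<close> have to hold together, which Ramsey's
  theorem provides. This gives the statement about \<open>tilde-\<Sigma>\<close> sets at once. For the statement about limits, a
  countable dense family of events and a diagonal argument yield one set \<open>S\<close> that serves all
  measurable sets (\<open>mixing_R_lim\<close>).

  \<^emph>\<open>Back to mixing.\<close> Call the property of two-set correlations along \<open>m\<close>-fold sums
  \<open>mixing_on_sums m\<close>. It passes from \<open>m\<close> to \<open>n + m\<close>, by fixing the first \<open>n\<close> indices. It passes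
  from \<open>2m\<close> to \<open>m\<close>: if \<open>s i\<close> are \<open>m\<close>-fold sums over successive blocks of indices, then
  \<open>s i' - s i\<close> is a \<open>2m\<close>-fold sum, so the events \<open>T (s i) ` A1\<close> are pairwise nearly independent, and
  Bessel's inequality makes one of them nearly independent of \<open>A0\<close>. For \<open>m \<ge> 1\<close> the chain
  \<open>m + 1 \<rightarrow> 2m \<rightarrow> m\<close> leads down to \<open>m = 1\<close>, which is strong mixing. The statements about many sets
  imply the one about two sets, since a sequence tending to infinity can be completed to a
  family of sequences that grow apart (\<open>extend_growing_apart\<close>), with the whole space assigned to the additional
  sequences.
\<close>

section \<open>Homogeneous sets of indices\<close>

text \<open>
  Ramsey's theorem for the colouring "good or bad" gives a homogeneous set; the bad colour is
  excluded because every infinite set contains a good \<open>\<alpha>\<close>. The conditions are treated one after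
  the other, each inside the set obtained for the previous ones.
\<close>
lemma homogeneous_finite_conditions:
  fixes P :: "'i \<Rightarrow> nat set \<Rightarrow> bool"
  assumes "finite I"
    and unavoidable: "\<And>i S. i \<in> I \<Longrightarrow> infinite S \<Longrightarrow> \<exists>\<alpha>\<in>nsets S m. P i \<alpha>"
    and "infinite S"
  shows "\<exists>S'\<subseteq>S. infinite S' \<and> (\<forall>\<alpha>\<in>nsets S' m. \<forall>i\<in>I. P i \<alpha>)"
  using assms(1,2)
proof (induction I rule: finite_induct)
  case empty
  then show ?case using \<open>infinite S\<close> by auto
next
  case (insert i I)
  then obtain S1 where S1: "S1 \<subseteq> S" "infinite S1" "\<forall>\<alpha>\<in>nsets S1 m. \<forall>i\<in>I. P i \<alpha>"
    by (metis insertCI)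
  obtain Y c where Y: "Y \<subseteq> S1" "infinite Y"
      "(\<lambda>\<alpha>. if P i \<alpha> then 0 else 1 :: nat) ` nsets Y m \<subseteq> {c}"
    by (rule Ramsey_nsets[of S1 "\<lambda>\<alpha>. if P i \<alpha> then 0 else 1" m 2]) (use S1 in auto)
  obtain \<alpha> where "\<alpha> \<in> nsets Y m" "P i \<alpha>"
    using insert.prems[of i Y] Y by auto
  with Y(3) have "c = 0" by force
  with Y(3) have "P i \<alpha>" if "\<alpha> \<in> nsets Y m" for \<alpha>
    using that by (auto simp: image_subset_iff split: if_splits)
  moreover have "nsets Y m \<subseteq> nsets S1 m" using Y by (simp add: nsets_mono)
  ultimately show ?case using S1 Y by (intro exI[of _ Y]) auto
qed

text \<open>
  Infinitely many conditions cannot be met on all of one infinite set, but a diagonal sequence meets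
  each of them on a tail. This tail is exactly the freedom that \<^const>\<open>R_lim\<close> leaves.
\<close>
lemma homogeneous_countable_conditions:
  fixes P :: "nat \<Rightarrow> nat set \<Rightarrow> bool"
  assumes unavoidable: "\<And>i S. infinite S \<Longrightarrow> \<exists>\<alpha>\<in>nsets S m. P i \<alpha>"
  shows "\<exists>S. infinite S \<and> (\<forall>i. \<exists>n. \<forall>\<alpha>\<in>nsets S m. (\<forall>x\<in>\<alpha>. n < x) \<longrightarrow> P i \<alpha>)"
proof -
  define Q where "Q n s \<longleftrightarrow> (\<forall>\<alpha>\<in>nsets (range s) m. P n \<alpha>)" for n and s :: "nat \<Rightarrow> nat"
  interpret subseqs Q
  proof
    fix n and s :: "nat \<Rightarrow> nat" assume s: "strict_mono s"
    have inf: "infinite (range s)"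
      using s by (simp add: range_inj_infinite strict_mono_imp_inj_on)
    obtain Y where Y: "Y \<subseteq> range s" "infinite Y" "\<forall>\<alpha>\<in>nsets Y m. P n \<alpha>"
      using homogeneous_finite_conditions[of "{n}" m P "range s"] unavoidable inf by auto
    define R where "R = s -` Y"
    have "s ` R = Y" using Y(1) unfolding R_def by auto
    then have "infinite R" using Y(2) by auto
    then have "strict_mono (enumerate R)" "range (s \<circ> enumerate R) = Y"
      using \<open>s ` R = Y\<close> range_enumerate[of R]
      by (simp_all add: strict_mono_enumerate image_comp[of s _ UNIV, symmetric] del: o_apply comp_apply)
    then show "\<exists>r'. strict_mono r' \<and> Q n (s \<circ> r')"
      unfolding Q_def using Y(3) by (intro exI[of _ "enumerate R"]) simp
  qed
  have hold: "Q k (diagseq \<circ> ((+) (Suc k)))" for k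
  proof (rule diagseq_holds)
    show "Q n (s \<circ> r)" if "Q n s" for r s n
      using that nsets_mono[of "range (s \<circ> r)" "range s" m] unfolding Q_def by fastforce
  qed
  have "\<forall>\<alpha>\<in>nsets (range diagseq) m. (\<forall>x\<in>\<alpha>. diagseq i < x) \<longrightarrow> P i \<alpha>" for i
  proof (intro ballI impI)
    fix \<alpha> assume \<alpha>: "\<alpha> \<in> nsets (range diagseq) m" and gt: "\<forall>x\<in>\<alpha>. diagseq i < x"
    have "\<alpha> \<subseteq> range (diagseq \<circ> ((+) (Suc i)))"
    proof
      fix x assume x: "x \<in> \<alpha>"
      then obtain j where j: "x = diagseq j" using \<alpha> by (auto simp: nsets_def)
      with gt x have "i < j" using subseq_diagseq by (auto simp: strict_mono_less)
      then have "j = Suc i + (j - Suc i)" by simp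
      then show "x \<in> range (diagseq \<circ> ((+) (Suc i)))" unfolding j comp_def by (metis rangeI)
    qed
    then show "P i \<alpha>" using hold[of i] \<alpha> unfolding Q_def nsets_def by auto
  qed
  moreover have "infinite (range diagseq)"
    using subseq_diagseq by (simp add: range_inj_infinite strict_mono_imp_inj_on)
  ultimately show ?thesis by blast
qed

text \<open>
  The set \<open>K\<close> is chosen greedily: each new element lies beyond the thresholds of all earlier ones.
\<close>
lemma spread_out_finite:
  assumes "\<And>k::nat. \<forall>\<^sub>F k' in sequentially. P k k'" and S: "infinite (S :: nat set)"
  shows "\<exists>K\<subseteq>S. finite K \<and> card K = N \<and> (\<forall>k\<in>K. \<forall>k'\<in>K. k < k' \<longrightarrow> P k k')"
proof (induction N)
  case 0
  show ?case by (intro exI[of _ "{}"]) auto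
next
  case (Suc N)
  then obtain K where K: "K \<subseteq> S" "finite K" "card K = N" "\<forall>k\<in>K. \<forall>k'\<in>K. k < k' \<longrightarrow> P k k'"
    by blast
  have "\<forall>\<^sub>F k' in sequentially. (\<forall>k\<in>K. P k k' \<and> k < k')"
    using K(2) assms(1) by (auto simp: eventually_ball_finite_distrib eventually_conj_iff eventually_gt_at_top)
  then obtain n where n: "\<forall>k'\<ge>n. \<forall>k\<in>K. P k k' \<and> k < k'"
    unfolding eventually_sequentially by blast
  obtain s where "s \<in> S" "s \<ge> n" using S infinite_nat_iff_unbounded_le by blast
  then have "s \<notin> K" "\<forall>k\<in>K. P k s \<and> k < s" using n by auto
  moreover from this have "card (insert s K) = Suc N" using K by simp
  ultimately have "insert s K \<subseteq> S \<and> finite (insert s K) \<and> card (insert s K) = Suc N \<and>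
      (\<forall>k\<in>insert s K. \<forall>k'\<in>insert s K. k < k' \<longrightarrow> P k k')"
    using K \<open>s \<in> S\<close> by (metis insert_iff insert_subset finite_insert less_asym less_irrefl)
  then show ?case ..
qed

section \<open>Sums along finite index sets\<close>

lemma sorted_list_of_set_Un:
  fixes \<alpha> \<beta> :: "'a::linorder set"
  assumes "finite \<alpha>" "finite \<beta>" and less: "\<And>x y. x \<in> \<alpha> \<Longrightarrow> y \<in> \<beta> \<Longrightarrow> x < y"
  shows "sorted_list_of_set (\<alpha> \<union> \<beta>) = sorted_list_of_set \<alpha> @ sorted_list_of_set \<beta>"
proof -
  have "sorted (sorted_list_of_set \<alpha> @ sorted_list_of_set \<beta>)"
    using assms by (auto simp: sorted_append dest: less_imp_le)
  moreover have "distinct (sorted_list_of_set \<alpha> @ sorted_list_of_set \<beta>)"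
    using assms by auto
  ultimately show ?thesis
    using assms by (intro sorted_distinct_set_unique) auto
qed

text \<open>
  Sums over a union of consecutive blocks split. The case of a singleton first block drives the induction for
  many sets, and the case of two blocks of equal size drives the reduction from \<open>2m\<close> to \<open>m\<close>.
\<close>
lemma sum_along_Un:
  assumes "\<alpha> \<in> nsets S m" "\<beta> \<in> nsets S' n" "\<And>x y. x \<in> \<alpha> \<Longrightarrow> y \<in> \<beta> \<Longrightarrow> x < y"
  shows "sum_along (m + n) g (\<alpha> \<union> \<beta>) = sum_along m g \<alpha> + sum_along n (\<lambda>k t. g k (m + t)) \<beta>"
proof -
  have fin: "finite \<alpha>" "finite \<beta>" "card \<alpha> = m" "card \<beta> = n"
    using assms by (auto simp: nsets_def)
  let ?f = "\<lambda>t. g (sorted_list_of_set (\<alpha> \<union> \<beta>) ! (t - 1)) t"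
  have nth: "sorted_list_of_set (\<alpha> \<union> \<beta>) = sorted_list_of_set \<alpha> @ sorted_list_of_set \<beta>"
    using fin assms(3) by (intro sorted_list_of_set_Un)
  have "(\<Sum>t=1..m + n. ?f t) = (\<Sum>t=1..m. ?f t) + (\<Sum>t=m+1..m + n. ?f t)"
    by (intro sum.ub_add_nat) simp
  also have "(\<Sum>t=m+1..m + n. ?f t) = (\<Sum>t=1..n. ?f (m + t))"
    by (rule sum.reindex_bij_witness[of _ "\<lambda>t. m + t" "\<lambda>t. t - m"]) auto
  also have "(\<Sum>t=1..m. ?f t) = sum_along m g \<alpha>"
    unfolding sum_along_def nth by (intro sum.cong) (auto simp: nth_append fin)
  also have "(\<Sum>t=1..n. ?f (m + t)) = sum_along n (\<lambda>k t. g k (m + t)) \<beta>"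
    unfolding sum_along_def nth by (intro sum.cong) (auto simp: nth_append fin)
  finally show ?thesis by (simp add: sum_along_def)
qed

lemma sum_along_strict_mono:
  assumes k: "strict_mono_on {1..m} (k :: nat \<Rightarrow> nat)"
  shows "sum_along m g (k ` {1..m}) = (\<Sum>t=1..m. g (k t) t)"
proof -
  have "sorted_list_of_set (k ` {1..m}) = map k [1..<Suc m]"
  proof (rule sorted_distinct_set_unique)
    show "sorted (map k [1..<Suc m])"
      by (rule sorted_map_mono)
         (use k in \<open>auto simp: atLeastLessThanSuc_atLeastAtMost strict_mono_on_imp_mono_on simp del: upt_Suc\<close>)
    show "distinct (map k [1..<Suc m])"
      using strict_mono_on_imp_inj_on[OF k] by (simp add: distinct_map atLeastLessThanSuc_atLeastAtMost del: upt_Suc)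
  qed (auto simp: atLeastLessThanSuc_atLeastAtMost simp del: upt_Suc)
  then show ?thesis
    unfolding sum_along_def by (auto intro!: sum.cong simp: nth_append simp del: upt_Suc)
qed

text \<open>
  With \<open>sum_along_strict_mono\<close>, this translates between index sets, used for limits along \<open>S\<close>, and
  increasing index functions, used for \<^const>\<open>tilde_Sigma\<close>.
\<close>
lemma nsets_eq_strict_mono_image:
  "nsets UNIV m = {k ` {1..m} | k :: nat \<Rightarrow> nat. strict_mono_on {1..m} k}"
proof (intro equalityI subsetI)
  fix \<alpha> :: "nat set" assume "\<alpha> \<in> nsets UNIV m"
  then have \<alpha>: "finite \<alpha>" "card \<alpha> = m" by (auto simp: nsets_def)
  define k where "k t = sorted_list_of_set \<alpha> ! (t - 1)" for t
  have "strict_mono_on {1..m} k"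
    unfolding k_def using \<alpha>
    by (intro strict_mono_onI sorted_wrt_nth_less[OF strict_sorted_list_of_set]) auto
  moreover have "k ` {1..m} = (\<lambda>i. sorted_list_of_set \<alpha> ! i) ` {..<m}"
    unfolding k_def by (force simp: image_iff Suc_le_eq intro: bexI[of _ "Suc _"])
  moreover have "\<dots> = set (sorted_list_of_set \<alpha>)"
    using \<alpha> by (auto simp: set_conv_nth)
  ultimately show "\<alpha> \<in> {k ` {1..m} | k :: nat \<Rightarrow> nat. strict_mono_on {1..m} k}"
    using \<alpha> by auto
next
  fix \<alpha> :: "nat set" assume "\<alpha> \<in> {k ` {1..m} | k :: nat \<Rightarrow> nat. strict_mono_on {1..m} k}"
  then show "\<alpha> \<in> nsets UNIV m"
    by (auto simp: nsets_def dest!: strict_mono_on_imp_inj_on card_image)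
qed

lemma sum_along_subsequence:
  assumes e: "strict_mono (e :: nat \<Rightarrow> nat)" and \<alpha>: "\<alpha> \<in> nsets UNIV m"
  shows "sum_along m (\<lambda>k. g (e k)) \<alpha> = sum_along m g (e ` \<alpha>)"
proof -
  obtain k where k: "strict_mono_on {1..m} k" "\<alpha> = k ` {1..m}"
    using \<alpha> unfolding nsets_eq_strict_mono_image by auto
  have "strict_mono_on {1..m} (e \<circ> k)"
    using k(1) e by (auto simp: strict_mono_on_def strict_mono_def)
  then show ?thesis
    using sum_along_strict_mono[of m "e \<circ> k" g] sum_along_strict_mono[OF k(1), of "\<lambda>k. g (e k)"]
    by (simp add: k(2) image_comp comp_def)
qed

section \<open>Sequences tending to infinity in a discrete group\<close>

lemma filterlim_inj_cofinite: "inj f \<Longrightarrow> filterlim f cofinite cofinite"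
  unfolding filterlim_iff eventually_cofinite
  using finite_vimageI[of "{x. \<not> _ x}" f] by (auto simp: vimage_def)

lemma grow_apart_fixed:
  fixes u :: "nat \<Rightarrow> 'g::ab_group_add"
  assumes "filterlim u cofinite sequentially"
  shows "grow_apart u (\<lambda>_. c)" "grow_apart (\<lambda>_. c) u"
proof -
  have "inj (\<lambda>x. x - c)" "inj (\<lambda>x. c - x)" by (auto simp: inj_def)
  then show "grow_apart u (\<lambda>_. c)" "grow_apart (\<lambda>_. c) u"
    unfolding grow_apart_def
    using filterlim_compose[OF filterlim_inj_cofinite assms] by blast+
qed

lemma grow_apart_sym: "grow_apart g h \<Longrightarrow> grow_apart h g"
  using filterlim_compose[OF filterlim_inj_cofinite[of uminus]]
  by (force simp: grow_apart_def)

text \<open>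
  The enumeration of the countable group serves as an exhaustion by finite sets.
\<close>
lemma filterlim_cofinite_avoiding:
  fixes u :: "nat \<Rightarrow> 'g::countable"
  assumes "\<And>k. k \<le> to_nat (u k)"
  shows "filterlim u cofinite sequentially"
  unfolding filterlim_iff eventually_cofinite
proof (intro allI impI)
  fix P :: "'g \<Rightarrow> bool" assume fin: "finite {x. \<not> P x}"
  define n where "n = Suc (Max (insert 0 (to_nat ` {x. \<not> P x})))"
  have "P (u k)" if "k \<ge> n" for k
  proof (rule ccontr)
    assume "\<not> P (u k)"
    then have "to_nat (u k) < n" unfolding n_def using fin by (simp add: less_Suc_eq_le)
    with assms[of k] that show False by simp
  qed
  then show "\<forall>\<^sub>F k in sequentially. P (u k)" unfolding eventually_sequentially by blast
qed

text \<open>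
  The existence of \<open>u\<close> forces the group to be infinite, so at each index \<open>k\<close> a value for the next
  sequence can be chosen outside any finite set; it avoids the first \<open>k\<close> group elements and their
  translates by the values already chosen.
\<close>
lemma extend_growing_apart:
  fixes u :: "nat \<Rightarrow> 'g::{ab_group_add,countable}"
  assumes u: "filterlim u cofinite sequentially" and "(n::nat) \<ge> 1"
  shows "\<exists>v. v 1 = u \<and> (\<forall>i\<in>{1..n}. filterlim (v i) cofinite sequentially) \<and>
    (\<forall>i\<in>{1..n}. \<forall>j\<in>{1..n}. i \<noteq> j \<longrightarrow> grow_apart (v i) (v j))"
  using \<open>n \<ge> 1\<close>
proof (induction n rule: nat_induct_at_least)
  case base
  show ?case using u by (intro exI[of _ "\<lambda>_. u"]) auto
next
  case (Suc n)
  then obtain v where v: "v 1 = u" "\<forall>i\<in>{1..n}. filterlim (v i) cofinite sequentially"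
    "\<forall>i\<in>{1..n}. \<forall>j\<in>{1..n}. i \<noteq> j \<longrightarrow> grow_apart (v i) (v j)" by blast
  have inf: "infinite (UNIV :: 'g set)"
  proof
    assume "finite (UNIV :: 'g set)"
    then have "(cofinite :: 'g filter) = bot" by simp
    with u show False by (simp add: filterlim_def le_bot filtermap_bot_iff bot_unique)
  qed
  have finF: "finite {x :: 'g. to_nat x < k}" for k :: nat
    by (rule finite_vimageI[of "{..<k}" to_nat, unfolded vimage_def lessThan_iff mem_Collect_eq])
       (auto simp: lessThan_def)
  have "\<exists>x. k \<le> to_nat x \<and> (\<forall>i\<in>{1..n}. k \<le> to_nat (x - v i k))" for k :: nat
  proof -
    have "finite ({x. to_nat x < k} \<union> (\<Union>i\<in>{1..n}. (+) (v i k) ` {x. to_nat x < k}))"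
      using finF by auto
    then obtain x where "x \<notin> {x. to_nat x < k} \<union> (\<Union>i\<in>{1..n}. (+) (v i k) ` {x. to_nat x < k})"
      using inf ex_new_if_finite by blast
    then show ?thesis
      by (intro exI[of _ x]) (force simp: image_iff not_less[symmetric])
  qed
  then obtain w where w: "\<And>k. k \<le> to_nat (w k)" "\<And>k i. i \<in> {1..n} \<Longrightarrow> k \<le> to_nat (w k - v i k)"
    by metis
  have "filterlim w cofinite sequentially" "\<And>i. i \<in> {1..n} \<Longrightarrow> grow_apart w (v i)"
    using w by (auto simp: grow_apart_def intro: filterlim_cofinite_avoiding)
  then show ?case
    using v Suc.hyps
    by (intro exI[of _ "v(Suc n := w)"]) (auto simp: le_Suc_eq intro: grow_apart_sym)
qed

section \<open>A Bessel inequality for events\<close>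

text \<open>
  Applied with two equal centres for correlations between events of a family, and with \<open>p = 0\<close> for
  the correlation with a fixed event.
\<close>
lemma (in prob_space) centered_indicators:
  fixes p q :: real
  assumes A: "A \<in> events" and B: "B \<in> events"
  shows "integrable M (\<lambda>x. (indicator A x - p) * (indicator B x - q))"
    and "expectation (\<lambda>x. (indicator A x - p) * (indicator B x - q))
      = prob (A \<inter> B) - q * prob A - p * prob B + p * q"
proof -
  have eq: "(\<lambda>x. (indicator A x - p) * (indicator B x - q))
      = (\<lambda>x. indicator (A \<inter> B) x - q * indicator A x - p * indicator B x + p * q)"
    by (auto simp: indicator_def algebra_simps)
  have int: "integrable M (indicat_real C)" if "C \<in> events" for C
    using that by (simp add: integrable_real_indicator less_top[symmetric])
  have AB: "A \<inter> B \<in> events" using A B by auto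
  note ints = int[OF A] int[OF B] int[OF AB]
  have ind: "expectation (indicat_real C) = prob C" if "C \<in> events" for C
    using that by simp
  show "integrable M (\<lambda>x. (indicator A x - p) * (indicator B x - q))"
    unfolding eq using ints by simp
  show "expectation (\<lambda>x. (indicator A x - p) * (indicator B x - q))
      = prob (A \<inter> B) - q * prob A - p * prob B + p * q"
    unfolding eq using ints ind[OF A] ind[OF B] ind[OF AB]
    by (simp add: prob_space del: integral_indicator)
qed

text \<open>
  A form of Bessel's inequality. If the correlations \<open>c k\<close> of \<open>A\<close> with the centred indicators
  \<open>f k\<close> were all at least \<open>\<delta>\<close> in absolute value, then \<open>A\<close> would have correlation at least \<open>N \<delta>\<close>
  with the signed sum \<open>F\<close> of the \<open>f k\<close>, where \<open>N\<close> is the number of events. But the \<open>f k\<close> are almost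
  orthogonal, so \<open>F\<close> has \<open>L\<^sup>2\<close> norm of order \<open>\<surd>N\<close>, up to an error of order \<open>N \<surd>\<eta>\<close>.
  The constants make both contributions small compared with \<open>N \<delta>\<close>.
\<close>
lemma (in prob_space) nearly_independent_events_meet:
  assumes K: "finite K" and A: "A \<in> events" and H: "\<And>k. k \<in> K \<Longrightarrow> H k \<in> events"
    and p: "0 \<le> p" "p \<le> 1"
    and single: "\<And>k. k \<in> K \<Longrightarrow> \<bar>prob (H k) - p\<bar> \<le> \<eta>"
    and pair: "\<And>k k'. k \<in> K \<Longrightarrow> k' \<in> K \<Longrightarrow> k \<noteq> k' \<Longrightarrow> \<bar>prob (H k \<inter> H k') - p\<^sup>2\<bar> \<le> \<eta>"
    and large: "2 \<le> real (card K) * \<delta>\<^sup>2" and small: "8 * \<eta> < \<delta>\<^sup>2" and "\<delta> > 0"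
  shows "\<exists>k\<in>K. \<bar>prob (A \<inter> H k) - prob A * p\<bar> < \<delta>"
proof (rule ccontr)
  define c where "c k = prob (A \<inter> H k) - prob A * p" for k
  assume "\<not> ?thesis"
  then have far: "\<delta> \<le> \<bar>c k\<bar>" if "k \<in> K" for k using that by (auto simp: c_def not_less)
  define N where "N = real (card K)"
  have N: "N > 0"
    using large by (cases "card K = 0") (auto simp: N_def)
  have "K \<noteq> {}" using N by (auto simp: N_def)
  then have \<eta>: "\<eta> \<ge> 0" using single by (meson abs_ge_zero all_not_in_conv order_trans)
  define f where "f k x = indicator (H k) x - p" for k x
  define F where "F x = (\<Sum>k\<in>K. sgn (c k) * f k x)" for x
  define a where "a x = (indicator A x :: real)" for x
  have int_af: "integrable M (\<lambda>x. a x * f k x)"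
    and af: "expectation (\<lambda>x. a x * f k x) = c k" if "k \<in> K" for k
    using centered_indicators[OF A H[OF that], of 0 p]
    by (simp_all add: a_def f_def c_def mult.commute)
  have int_ff: "integrable M (\<lambda>x. f k x * f k' x)"
    and ff: "expectation (\<lambda>x. f k x * f k' x)
      = prob (H k \<inter> H k') - p * prob (H k) - p * prob (H k') + p\<^sup>2"
    if "k \<in> K" "k' \<in> K" for k k'
    using centered_indicators[OF H[OF that(1)] H[OF that(2)], of p p]
    by (simp_all add: f_def power2_eq_square)
  have corr: "\<bar>expectation (\<lambda>x. f k x * f k' x)\<bar> \<le> (if k = k' then 1 else 0) + 3 * \<eta>"
    if k: "k \<in> K" "k' \<in> K" for k k'
  proof (cases "k = k'")
    case True
    have "\<bar>f k x\<bar> \<le> 1" for x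
      using p by (simp add: f_def indicator_def)
    then have f_le: "f k x * f k x \<le> 1" for x
      by (simp add: abs_square_le_1 flip: power2_eq_square)
    have "expectation (\<lambda>x. f k x * f k x) \<le> expectation (\<lambda>x. 1)"
      using int_ff[OF k(1) k(1)] f_le by (intro integral_mono) auto
    moreover have "expectation (\<lambda>x. f k x * f k x) \<ge> 0" by (rule Bochner_Integration.integral_nonneg) simp
    ultimately show ?thesis using True \<eta> by (simp add: prob_space)
  next
    case False
    have pp: "p * \<bar>q\<bar> \<le> \<eta>" if "\<bar>q\<bar> \<le> \<eta>" for q
      using mult_mono[OF p(2) that] p \<eta> by simp
    have "expectation (\<lambda>x. f k x * f k' x)
        = (prob (H k \<inter> H k') - p\<^sup>2) - p * (prob (H k) - p) - p * (prob (H k') - p)"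
      unfolding ff[OF k] by (simp add: power2_eq_square algebra_simps)
    moreover have "\<bar>p * (prob (H k) - p)\<bar> \<le> 1 * \<eta>" "\<bar>p * (prob (H k') - p)\<bar> \<le> 1 * \<eta>"
      unfolding abs_mult using single k p pp by auto
    ultimately show ?thesis using pair[OF k False] False by auto
  qed
  have F2: "(F x)\<^sup>2 = (\<Sum>k\<in>K. \<Sum>k'\<in>K. sgn (c k) * sgn (c k') * (f k x * f k' x))" for x
    unfolding F_def power2_eq_square sum_product by (simp add: ac_simps)
  have int_F2: "integrable M (\<lambda>x. (F x)\<^sup>2)"
    unfolding F2 by (intro Bochner_Integration.integrable_sum integrable_mult_right int_ff)
  have "expectation (\<lambda>x. (F x)\<^sup>2)
      = (\<Sum>k\<in>K. \<Sum>k'\<in>K. sgn (c k) * sgn (c k') * expectation (\<lambda>x. f k x * f k' x))"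
    unfolding F2 using int_ff by simp
  also have "\<dots> \<le> (\<Sum>k\<in>K. \<Sum>k'\<in>K. (if k = k' then 1 else 0) + 3 * \<eta>)"
  proof (intro sum_mono)
    fix k k' assume k: "k \<in> K" "k' \<in> K"
    have "sgn (c k) * sgn (c k') * expectation (\<lambda>x. f k x * f k' x)
        \<le> \<bar>sgn (c k) * sgn (c k')\<bar> * \<bar>expectation (\<lambda>x. f k x * f k' x)\<bar>"
      by (metis abs_ge_self abs_mult)
    also have "\<dots> \<le> 1 * \<bar>expectation (\<lambda>x. f k x * f k' x)\<bar>"
      by (intro mult_right_mono) (auto simp: abs_mult sgn_if)
    finally show "sgn (c k) * sgn (c k') * expectation (\<lambda>x. f k x * f k' x)
        \<le> (if k = k' then 1 else 0) + 3 * \<eta>"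
      using corr[OF k] by linarith
  qed
  also have "\<dots> = N + 3 * \<eta> * N\<^sup>2"
    using K by (simp add: sum.distrib N_def power2_eq_square algebra_simps)
  finally have EF2: "expectation (\<lambda>x. (F x)\<^sup>2) \<le> N + 3 * \<eta> * N\<^sup>2" .
  have aF: "a x * F x = (\<Sum>k\<in>K. sgn (c k) * (a x * f k x))" for x
    unfolding F_def sum_distrib_left by (simp add: ac_simps)
  have int_aF: "integrable M (\<lambda>x. a x * F x)"
    unfolding aF by (intro Bochner_Integration.integrable_sum integrable_mult_right int_af)
  have "expectation (\<lambda>x. a x * F x) = (\<Sum>k\<in>K. sgn (c k) * c k)"
    unfolding aF using af int_af by simp
  also have "\<dots> = (\<Sum>k\<in>K. \<bar>c k\<bar>)" by (simp add: abs_sgn mult.commute)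
  also have "\<dots> \<ge> N * \<delta>" using sum_bounded_below[of K \<delta> "\<lambda>k. \<bar>c k\<bar>"] far by (simp add: N_def)
  finally have EaF: "N * \<delta> \<le> expectation (\<lambda>x. a x * F x)" .
  define r where "r = N * \<delta>"
  have "r > 0" using N \<open>\<delta> > 0\<close> by (simp add: r_def)
  \<comment> \<open>Cauchy--Schwarz in the form \<open>2ab \<le> a\<^sup>2 + b\<^sup>2\<close>, weighted by the lower bound \<open>r\<close> for the correlation of \<open>A\<close> with \<open>F\<close>.\<close>
  have "expectation (\<lambda>x. 2 * r * (a x * F x)) \<le> expectation (\<lambda>x. r\<^sup>2 + (F x)\<^sup>2)"
  proof (intro integral_mono)
    show "2 * r * (a x * F x) \<le> r\<^sup>2 + (F x)\<^sup>2" for x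
      using sum_squares_bound[of r "F x"] \<open>r > 0\<close>
      by (cases "x \<in> A") (auto simp: a_def)
  qed (use int_aF int_F2 in auto)
  then have "2 * r * expectation (\<lambda>x. a x * F x) \<le> r\<^sup>2 + expectation (\<lambda>x. (F x)\<^sup>2)"
    using int_F2 by (simp add: prob_space)
  moreover have "2 * r * r \<le> 2 * r * expectation (\<lambda>x. a x * F x)"
    using EaF \<open>r > 0\<close> by (intro mult_left_mono) (auto simp: r_def)
  ultimately have "r\<^sup>2 \<le> N + 3 * \<eta> * N\<^sup>2"
    using EF2 by (simp add: power2_eq_square)
  moreover have "2 * N \<le> r\<^sup>2"
    using mult_right_mono[OF large, of N] N by (simp add: r_def N_def power2_eq_square ac_simps)
  moreover have "8 * \<eta> * N\<^sup>2 < r\<^sup>2"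
    using mult_strict_right_mono[OF small, of "N\<^sup>2"] N by (simp add: r_def power_mult_distrib ac_simps)
  moreover have "\<eta> * N\<^sup>2 \<ge> 0" using \<eta> by simp
  ultimately show False using N by linarith
qed

section \<open>Translates of measurable sets\<close>

context measure_preserving_system
begin

lemma T_in_space: "x \<in> space M \<Longrightarrow> T g x \<in> space M"
  using T_measurable[of g] by (auto simp: measurable_def)

lemma T_inverse:
  assumes "x \<in> space M"
  shows "T (- g) (T g x) = x" "T g (T (- g) x) = x"
  using T_add[OF assms, of "- g" g] T_add[OF assms, of g "- g"] T_zero[OF assms] by auto

text \<open>
  Images under \<open>T g\<close> are preimages under \<open>T (- g)\<close>, so measurability and invariance of measure,
  which are given for preimages, carry over to images.
\<close>
lemma T_image_eq_vimage:
  assumes "A \<subseteq> space M"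
  shows "T g ` A = T (- g) -` A \<inter> space M"
proof (intro equalityI subsetI)
  fix y assume "y \<in> T g ` A"
  then obtain x where "x \<in> A" "y = T g x" by blast
  then show "y \<in> T (- g) -` A \<inter> space M"
    using assms T_in_space[of x g] T_inverse(1)[of x g] by auto
next
  fix y assume "y \<in> T (- g) -` A \<inter> space M"
  then have "T (- g) y \<in> A" "y = T g (T (- g) y)" using T_inverse(2)[of y g] by auto
  then show "y \<in> T g ` A" by blast
qed

lemma T_image_sets [simp]:
  assumes "A \<in> sets M"
  shows "T g ` A \<in> sets M"
  unfolding T_image_eq_vimage[OF sets.sets_into_space[OF assms]]
  by (rule measurable_sets[OF T_measurable assms])

lemma T_image_subset: "A \<subseteq> space M \<Longrightarrow> T g ` A \<subseteq> space M"
  using T_in_space by auto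

lemma measure_T_image [simp]:
  assumes "A \<in> sets M"
  shows "measure M (T g ` A) = measure M A"
proof -
  have "measure M (T g ` A) = measure M (T (- g) -` A \<inter> space M)"
    unfolding T_image_eq_vimage[OF sets.sets_into_space[OF assms]] ..
  also have "\<dots> = measure (distr M M (T (- g))) A"
    by (rule measure_distr[OF T_measurable assms, symmetric])
  finally show ?thesis unfolding T_preserves .
qed

lemma T_image_image:
  assumes "A \<subseteq> space M"
  shows "T g ` T h ` A = T (g + h) ` A"
  unfolding image_image by (intro image_cong refl T_add[symmetric] subsetD[OF assms])

lemma T_image_zero: "A \<subseteq> space M \<Longrightarrow> T 0 ` A = A"
  by (subst image_cong[OF refl, of A "T 0" id]) (auto intro: T_zero)

lemma T_image_space: "T g ` space M = space M"
  using T_in_space unfolding T_image_eq_vimage[OF order_refl] by auto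

lemma inj_on_T: "inj_on (T g) (space M)"
  by (rule inj_on_inverseI[of _ "T (- g)"]) (rule T_inverse)

lemma T_image_Int:
  assumes "A \<subseteq> space M" "B \<subseteq> space M"
  shows "T g ` (A \<inter> B) = T g ` A \<inter> T g ` B"
  by (rule inj_on_image_Int[OF inj_on_T assms])

lemma T_image_INT:
  assumes "j \<in> J" "\<And>j. j \<in> J \<Longrightarrow> A j \<subseteq> space M"
  shows "T g ` (\<Inter>j\<in>J. A j) = (\<Inter>j\<in>J. T g ` A j)"
  by (rule image_INT[OF inj_on_T _ assms(1)]) (use assms(2) in blast)

lemma mixing_tendsto:
  assumes "strongly_mixing M T" "filterlim u cofinite F" "A \<in> sets M" "B \<in> sets M"
  shows "((\<lambda>k. measure M (A \<inter> T (u k) ` B)) \<longlongrightarrow> measure M A * measure M B) F"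
proof (rule filterlim_compose[OF _ assms(2)])
  show "((\<lambda>g. measure M (A \<inter> T g ` B)) \<longlongrightarrow> measure M A * measure M B) cofinite"
    using assms by (simp add: strongly_mixing_def)
qed

section \<open>Correlations of many sets in a mixing system\<close>

text \<open>
  All sequences are treated on an equal footing here: the set that is not moved in the correlation
  corresponds to the zero sequence, from which a sequence is essentially distinct exactly if it is
  non-degenerated. This symmetric form is what makes the induction work, since the induction
  hypothesis is applied to the sequences \<open>h j\<close> with \<open>j \<noteq> j0\<close>, none of which is distinguished.
\<close>
theorem mixing_along_sums:
  fixes g :: "'i \<Rightarrow> nat \<Rightarrow> nat \<Rightarrow> 'g" and A :: "'i \<Rightarrow> 'x set"
  assumes mix: "strongly_mixing M T"
    and "finite J" "card J = Suc m"
    and "\<And>i j. i \<in> J \<Longrightarrow> j \<in> J \<Longrightarrow> i \<noteq> j \<Longrightarrow> essentially_distinct m (g i) (g j)"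
    and "\<And>j. j \<in> J \<Longrightarrow> A j \<in> sets M" and "\<epsilon> > 0" and "infinite S"
  shows "\<exists>\<alpha>\<in>nsets S m.
    \<bar>measure M (\<Inter>j\<in>J. T (sum_along m (g j) \<alpha>) ` A j) - (\<Prod>j\<in>J. measure M (A j))\<bar> < \<epsilon>"
  using assms(2-)
proof (induction m arbitrary: J g A \<epsilon> S)
  case 0
  then obtain j where "J = {j}" by (auto simp: card_Suc_eq)
  with 0 show ?case
    by (simp add: sum_along_def T_image_zero sets.sets_into_space nsets_def cong: conj_cong)
next
  case (Suc m)
  note A = Suc.prems(4)
  note sub = sets.sets_into_space[OF A]
  have "J \<noteq> {}" using Suc.prems(2) by auto
  then obtain j0 where j0: "j0 \<in> J" by blast
  define J' where "J' = J - {j0}"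
  have card_J': "card J' = Suc m" using Suc.prems(1,2) j0 by (simp add: J'_def)
  then have "J' \<noteq> {}" by force
  then have J': "finite J'" "card J' = Suc m" "J' \<subseteq> J" "J' \<noteq> {}" "J = insert j0 J'" "j0 \<notin> J'"
    using Suc.prems(1) j0 card_J' by (auto simp: J'_def)
  define a where "a j k = g j k 1 - g j0 k 1" for j k
  define h where "h j k t = g j k (1 + t) - g j0 k (1 + t)" for j k t
  have a_lim: "filterlim (a j) cofinite sequentially" if "j \<in> J'" for j
  proof -
    have "essentially_distinct (Suc m) (g j) (g j0)"
      using Suc.prems(3)[of j j0] that j0 J'(3,6) by blast
    then show ?thesis by (simp add: essentially_distinct_def grow_apart_def a_def[abs_def])
  qed
  have h_distinct: "essentially_distinct m (h i) (h j)" if "i \<in> J'" "j \<in> J'" "i \<noteq> j" for i j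
    unfolding essentially_distinct_def
  proof
    fix t assume "t \<in> {1..m}"
    then have "grow_apart (\<lambda>k. g i k (1 + t)) (\<lambda>k. g j k (1 + t))"
      using Suc.prems(3)[of i j] that J' by (auto simp: essentially_distinct_def)
    then show "grow_apart (\<lambda>k. h i k t) (\<lambda>k. h j k t)" by (simp add: grow_apart_def h_def)
  qed
  define p where "p = (\<Prod>j\<in>J'. measure M (A j))"
  have p: "0 \<le> p" "p \<le> 1" unfolding p_def by (auto intro!: prod_nonneg prod_le_1)
  obtain N :: nat where "2 / \<epsilon>\<^sup>2 \<le> real N" using real_arch_simple by blast
  then have N: "2 \<le> real N * \<epsilon>\<^sup>2" using \<open>\<epsilon> > 0\<close> by (simp add: divide_le_eq)
  define \<eta> where "\<eta> = \<epsilon>\<^sup>2 / 10"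
  have \<eta>: "\<eta> > 0" "8 * \<eta> < \<epsilon>\<^sup>2" using \<open>\<epsilon> > 0\<close> by (auto simp: \<eta>_def)
  \<comment> \<open>The sets \<open>C k k' j\<close> arise when the events \<open>H \<beta> k\<close> and \<open>H \<beta> k'\<close> below are intersected.\<close>
  define C where "C k k' j = T (a j k) ` A j \<inter> T (a j k') ` A j" for k k' j
  have C_sets: "C k k' j \<in> sets M" if "j \<in> J'" for k k' j
    using A[of j] that J' by (auto simp: C_def)
  \<comment> \<open>Half of \<open>\<eta>\<close> is spent on the \<open>m + 1\<close> factors of the product, the other half on the induction hypothesis.\<close>
  define \<zeta> where "\<zeta> = \<eta> / (2 * Suc m)"
  have "\<zeta> > 0" using \<eta> by (simp add: \<zeta>_def)
  have "\<forall>\<^sub>F k' in sequentially. \<forall>j\<in>J'. \<bar>measure M (C k k' j) - (measure M (A j))\<^sup>2\<bar> < \<zeta>" for k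
  proof (intro eventually_ball_finite[OF J'(1)] ballI)
    fix j assume j: "j \<in> J'"
    then have "A j \<in> sets M" using A J' by auto
    then have "(\<lambda>k'. measure M (C k k' j)) \<longlonglongrightarrow> (measure M (A j))\<^sup>2"
      using mixing_tendsto[OF mix a_lim[OF j], of "T (a j k) ` A j" "A j"]
      by (simp add: C_def power2_eq_square)
    from tendstoD[OF this \<open>\<zeta> > 0\<close>]
    show "\<forall>\<^sub>F k' in sequentially. \<bar>measure M (C k k' j) - (measure M (A j))\<^sup>2\<bar> < \<zeta>"
      by (simp add: dist_real_def)
  qed
  from spread_out_finite[where P = "\<lambda>k k'. \<forall>j\<in>J'. \<bar>measure M (C k k' j) - (measure M (A j))\<^sup>2\<bar> < \<zeta>",
      OF this \<open>infinite S\<close>, of N]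
  obtain K where K: "K \<subseteq> S" "finite K" "card K = N"
    "\<And>k k' j. k \<in> K \<Longrightarrow> k' \<in> K \<Longrightarrow> k < k' \<Longrightarrow> j \<in> J' \<Longrightarrow> \<bar>measure M (C k k' j) - (measure M (A j))\<^sup>2\<bar> < \<zeta>"
    by metis
  have C_pair: "\<bar>(\<Prod>j\<in>J'. measure M (C k k' j)) - p\<^sup>2\<bar> \<le> \<eta> / 2" if k: "k \<in> K" "k' \<in> K" "k \<noteq> k'" for k k'
  proof -
    have *: "\<bar>measure M (C k k' j) - (measure M (A j))\<^sup>2\<bar> \<le> \<zeta>" if "j \<in> J'" for j
      using K(4)[of k k' j] K(4)[of k' k j] k that
      by (cases k k' rule: linorder_cases) (auto simp: C_def Int_commute)
    have "\<bar>(\<Prod>j\<in>J'. measure M (C k k' j)) - (\<Prod>j\<in>J'. (measure M (A j))\<^sup>2)\<bar>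
        \<le> (\<Sum>j\<in>J'. \<bar>measure M (C k k' j) - (measure M (A j))\<^sup>2\<bar>)"
      using norm_prod_diff[of J' "\<lambda>j. measure M (C k k' j)" "\<lambda>j. (measure M (A j))\<^sup>2"]
      by (simp add: power_le_one)
    also have "\<dots> \<le> of_nat (card J') * \<zeta>" using * by (rule sum_bounded_above)
    also have "\<dots> = \<eta> / 2" by (simp add: J'(2) \<zeta>_def field_simps)
    finally show ?thesis by (simp add: p_def prod_power_distrib)
  qed
  have C_single: "(\<Prod>j\<in>J'. measure M (C k k j)) = p" for k
    unfolding p_def using A J' by (intro prod.cong) (auto simp: C_def)
  define H where "H \<beta> k = (\<Inter>j\<in>J'. T (sum_along m (h j) \<beta>) ` T (a j k) ` A j)" for \<beta> k
  \<comment> \<open>The diagonal pairs \<open>k = k'\<close> are included: they control the measure of \<open>H \<beta> k\<close> itself.\<close>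
  define good where "good = (\<lambda>(k, k') \<beta>. \<bar>measure M (\<Inter>j\<in>J'. T (sum_along m (h j) \<beta>) ` C k k' j)
      - (\<Prod>j\<in>J'. measure M (C k k' j))\<bar> < \<eta> / 2)"
  have "\<exists>\<beta>\<in>nsets S' m. good kk \<beta>" if "infinite S'" for kk S'
  proof (cases kk)
    case (Pair k k')
    have "\<eta> / 2 > 0" using \<eta> by simp
    from Suc.IH[OF J'(1,2) h_distinct C_sets[of _ k k'] this that]
    show ?thesis by (simp add: good_def Pair)
  qed
  \<comment> \<open>Removing the indices up to \<open>Max K\<close> puts every \<open>k \<in> K\<close> below every element of \<open>\<beta>\<close>.\<close>
  moreover have "infinite (S - {..Max K})" using Suc.prems(6) by (simp add: Diff_infinite_finite)
  ultimately obtain S' where S': "S' \<subseteq> S - {..Max K}" "infinite S'"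
      "\<And>\<beta> kk. \<beta> \<in> nsets S' m \<Longrightarrow> kk \<in> K \<times> K \<Longrightarrow> good kk \<beta>"
    using homogeneous_finite_conditions[of "K \<times> K" m good "S - {..Max K}"] K(2) by auto
  obtain \<beta> where \<beta>: "\<beta> \<in> nsets S' m"
    using infinite_arbitrarily_large[OF S'(2), of m] by (auto simp: nsets_def)
  have later: "k < x" if "k \<in> K" "x \<in> \<beta>" for k x
    using \<beta> S'(1) Max_ge[OF K(2) that(1)] that(2) by (force simp: nsets_def)
  have H_Int: "H \<beta> k \<inter> H \<beta> k' = (\<Inter>j\<in>J'. T (sum_along m (h j) \<beta>) ` C k k' j)" for k k'
  proof -
    have "T (sum_along m (h j) \<beta>) ` C k k' j
        = T (sum_along m (h j) \<beta>) ` T (a j k) ` A j \<inter> T (sum_along m (h j) \<beta>) ` T (a j k') ` A j"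
      if "j \<in> J'" for j
      unfolding C_def using sub[of j] that J' by (intro T_image_Int T_image_subset) auto
    then show ?thesis unfolding H_def using J'(4) by auto
  qed
  have H_pair: "\<bar>measure M (H \<beta> k \<inter> H \<beta> k') - (\<Prod>j\<in>J'. measure M (C k k' j))\<bar> < \<eta> / 2"
    if "k \<in> K" "k' \<in> K" for k k'
    using S'(3)[OF \<beta>, of "(k, k')"] that unfolding good_def H_Int by simp
  have "\<exists>k\<in>K. \<bar>measure M (A j0 \<inter> H \<beta> k) - measure M (A j0) * p\<bar> < \<epsilon>"
  proof (rule nearly_independent_events_meet[where \<eta> = \<eta>])
    show "H \<beta> k \<in> sets M" for k
      unfolding H_def using J' A by (intro sets.finite_INT) auto
    show "\<bar>measure M (H \<beta> k) - p\<bar> \<le> \<eta>" if "k \<in> K" for k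
      using H_pair[OF that that] \<eta> by (simp add: C_single)
    show "\<bar>measure M (H \<beta> k \<inter> H \<beta> k') - p\<^sup>2\<bar> \<le> \<eta>" if "k \<in> K" "k' \<in> K" "k \<noteq> k'" for k k'
      using H_pair[OF that(1,2)] C_pair[OF that] by linarith
  qed (use K N \<eta> A j0 p \<open>\<epsilon> > 0\<close> in auto)
  then obtain k where k: "k \<in> K" "\<bar>measure M (A j0 \<inter> H \<beta> k) - measure M (A j0) * p\<bar> < \<epsilon>" by blast
  define \<alpha> where "\<alpha> = {k} \<union> \<beta>"
  \<comment> \<open>The whole intersection is moved by \<open>T (- c)\<close>, after which the set with index \<open>j0\<close> stays in place.\<close>
  define c where "c = sum_along (Suc m) (g j0) \<alpha>"
  have "\<alpha> \<in> nsets S (Suc m)"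
    using \<beta> S'(1) k(1) K(1) later[of k k] by (auto simp: \<alpha>_def nsets_def card_insert_if)
  have "sum_along (Suc m) (g j) \<alpha> = g j k 1 + sum_along m (\<lambda>k t. g j k (1 + t)) \<beta>" for j
    using sum_along_Un[of "{k}" UNIV 1 \<beta> S' m "g j"] \<beta> later[OF k(1)]
    by (simp add: \<alpha>_def sum_along_def[of "Suc 0"] nsets_def)
  then have sums: "sum_along (Suc m) (g j) \<alpha> = c + (sum_along m (h j) \<beta> + a j k)" for j
    by (simp add: c_def a_def h_def sum_along_def sum_subtractf)
  have "sum_along m (h j0) \<beta> + a j0 k = 0" by (simp add: h_def a_def sum_along_def)
  with sums[of j0] have sums0: "sum_along (Suc m) (g j0) \<alpha> = c" by simp
  have split: "T (sum_along (Suc m) (g j) \<alpha>) ` A j = T c ` T (sum_along m (h j) \<beta>) ` T (a j k) ` A j"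
    if "j \<in> J'" for j
  proof -
    have "A j \<subseteq> space M" using sub that J'(3) by blast
    then show ?thesis by (simp only: sums T_image_image T_image_subset)
  qed
  have "(\<Inter>j\<in>J. T (sum_along (Suc m) (g j) \<alpha>) ` A j)
      = T c ` A j0 \<inter> (\<Inter>j\<in>J'. T c ` T (sum_along m (h j) \<beta>) ` T (a j k) ` A j)"
    unfolding J'(5) INT_insert sums0
    by (intro arg_cong2[where f = "(\<inter>)"] refl INF_cong split)
  also have "\<dots> = T c ` (A j0 \<inter> H \<beta> k)"
  proof -
    obtain j1 where "j1 \<in> J'" using J'(4) by blast
    have part: "T (sum_along m (h j) \<beta>) ` T (a j k) ` A j \<subseteq> space M" if "j \<in> J'" for j
      using sub[of j] that J'(3) by (intro T_image_subset) auto
    then have "H \<beta> k \<subseteq> space M" unfolding H_def using \<open>j1 \<in> J'\<close> by blast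
    then show ?thesis
      using T_image_INT[OF \<open>j1 \<in> J'\<close> part] T_image_Int[OF sub[OF j0]] by (simp add: H_def)
  qed
  also have "measure M \<dots> = measure M (A j0 \<inter> H \<beta> k)"
    unfolding H_def using J' A j0 by (intro measure_T_image sets.Int sets.finite_INT) auto
  finally have measure_eq: "measure M (\<Inter>j\<in>J. T (sum_along (Suc m) (g j) \<alpha>) ` A j)
      = measure M (A j0 \<inter> H \<beta> k)" .
  have "(\<Prod>j\<in>J. measure M (A j)) = measure M (A j0) * p"
    unfolding J'(5) p_def using J' by simp
  with k(2) \<open>\<alpha> \<in> nsets S (Suc m)\<close> show ?case
    unfolding measure_eq[symmetric] by (metis (no_types, lifting))
qed

end

section \<open>Approximation of events by a countable family\<close>

text \<open>
  Closing a countable set under complements and unions takes countably many steps, each of which keeps it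
  countable.
\<close>
lemma countable_subalgebra_containing:
  fixes M :: "'a measure"
  assumes "countable G" "G \<subseteq> sets M"
  obtains \<D> where "countable \<D>" "G \<subseteq> \<D>" "\<D> \<subseteq> sets M" "\<And>D. D \<in> \<D> \<Longrightarrow> space M - D \<in> \<D>"
    "\<And>D E. D \<in> \<D> \<Longrightarrow> E \<in> \<D> \<Longrightarrow> D \<union> E \<in> \<D>"
proof -
  define L where "L = rec_nat G (\<lambda>_ L. L \<union> (-) (space M) ` L \<union> (\<lambda>(D, E). D \<union> E) ` (L \<times> L))"
  have L0: "L 0 = G"
    and LS: "L (Suc n) = L n \<union> (-) (space M) ` L n \<union> (\<lambda>(D, E). D \<union> E) ` (L n \<times> L n)" for n
    by (simp_all add: L_def)
  have mono: "L m \<subseteq> L n" if "m \<le> n" for m n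
    using that by (rule lift_Suc_mono_le[rotated]) (auto simp: LS)
  have count: "countable (L n)" for n
    by (induction n) (auto simp: L0 LS assms)
  have sets: "L n \<subseteq> sets M" for n
    by (induction n) (use assms in \<open>auto simp: L0 LS\<close>)
  have "space M - D \<in> (\<Union>n. L n)" if D: "D \<in> (\<Union>n. L n)" for D
  proof -
    from D obtain n where "D \<in> L n" by blast
    then have "space M - D \<in> L (Suc n)" by (auto simp: LS)
    then show ?thesis by blast
  qed
  moreover have "D \<union> E \<in> (\<Union>n. L n)" if D: "D \<in> (\<Union>n. L n)" and E: "E \<in> (\<Union>n. L n)" for D E
  proof -
    from D obtain m where "D \<in> L m" by blast
    moreover from E obtain n where "E \<in> L n" by blast
    ultimately have "D \<in> L (max m n)" "E \<in> L (max m n)" using mono by (meson max.cobounded1 max.cobounded2 subsetD)+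
    then have "D \<union> E \<in> L (Suc (max m n))" by (auto simp: LS)
    then show ?thesis by blast
  qed
  moreover have "G \<subseteq> (\<Union>n. L n)" using L0 by blast
  moreover have "countable (\<Union>n. L n)" "(\<Union>n. L n) \<subseteq> sets M" using count sets by blast+
  ultimately show ?thesis using that[of "\<Union>n. L n"] by blast
qed

lemma (in finite_measure) measure_diff_le_sym_diff:
  assumes "A \<in> sets M" "B \<in> sets M"
  shows "\<bar>measure M A - measure M B\<bar> \<le> measure M ((A - B) \<union> (B - A))"
proof -
  have le: "measure M A \<le> measure M B + measure M ((A - B) \<union> (B - A))"
    if "A \<in> sets M" "B \<in> sets M" for A B
  proof -
    have "measure M A \<le> measure M (B \<union> ((A - B) \<union> (B - A)))"
      using that by (intro finite_measure_mono) auto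
    also have "\<dots> \<le> measure M B + measure M ((A - B) \<union> (B - A))"
      using that by (intro measure_Un_le) auto
    finally show ?thesis .
  qed
  show ?thesis using le[OF assms] le[OF assms(2,1)] by (simp add: Un_commute abs_le_iff)
qed

text \<open>
  Finite unions are approximated termwise; a countable union is exhausted by finite ones up to small
  measure.
\<close>
lemma (in finite_measure) approximable_UN:
  fixes A :: "nat \<Rightarrow> 'a set"
  assumes \<D>: "\<D> \<subseteq> sets M" "{} \<in> \<D>" "\<And>D E. D \<in> \<D> \<Longrightarrow> E \<in> \<D> \<Longrightarrow> D \<union> E \<in> \<D>"
    and A: "\<And>i. A i \<in> sets M"
    and approx: "\<And>i \<delta>. \<delta> > 0 \<Longrightarrow> \<exists>D\<in>\<D>. measure M ((A i - D) \<union> (D - A i)) < \<delta>"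
    and "\<delta> > 0"
  shows "\<exists>D\<in>\<D>. measure M (((\<Union>i. A i) - D) \<union> (D - (\<Union>i. A i))) < \<delta>"
proof -
  define U where "U n = (\<Union>i<n. A i)" for n
  have U_sets: "U n \<in> sets M" for n unfolding U_def using A by auto
  have U_approx: "\<exists>D\<in>\<D>. measure M ((U n - D) \<union> (D - U n)) < \<delta>" if "\<delta> > 0" for n \<delta>
    using that
  proof (induction n arbitrary: \<delta>)
    case 0
    then show ?case using \<D>(2) by (intro bexI[of _ "{}"]) (auto simp: U_def)
  next
    case (Suc n)
    then obtain D where D: "D \<in> \<D>" "measure M ((U n - D) \<union> (D - U n)) < \<delta> / 2"
      using half_gt_zero by blast
    obtain E where E: "E \<in> \<D>" "measure M ((A n - E) \<union> (E - A n)) < \<delta> / 2"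
      using approx[of "\<delta> / 2" n] Suc.prems by auto
    have sets: "D \<in> sets M" "E \<in> sets M" using D E \<D> by auto
    have "U (Suc n) = U n \<union> A n" by (auto simp: U_def less_Suc_eq)
    then have "measure M ((U (Suc n) - (D \<union> E)) \<union> ((D \<union> E) - U (Suc n)))
        \<le> measure M (((U n - D) \<union> (D - U n)) \<union> ((A n - E) \<union> (E - A n)))"
      using sets U_sets A by (intro finite_measure_mono) auto
    also have "\<dots> \<le> measure M ((U n - D) \<union> (D - U n)) + measure M ((A n - E) \<union> (E - A n))"
      using sets U_sets A by (intro measure_Un_le) auto
    finally show ?case using D E \<D>(3) by (intro bexI[of _ "D \<union> E"]) auto
  qed
  have UN: "(\<Union>n. U n) = (\<Union>i. A i)" by (auto simp: U_def)
  have "(\<lambda>n. measure M (U n)) \<longlonglongrightarrow> measure M (\<Union>n. U n)"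
    using U_sets by (intro finite_Lim_measure_incseq) (force simp: incseq_def U_def)+
  from LIMSEQ_D[OF this, of "\<delta> / 2"] \<open>\<delta> > 0\<close>
  obtain n where n: "\<bar>measure M (U n) - measure M (\<Union>i. A i)\<bar> < \<delta> / 2"
    unfolding UN by auto
  obtain D where D: "D \<in> \<D>" "measure M ((U n - D) \<union> (D - U n)) < \<delta> / 2"
    using U_approx[of "\<delta> / 2" n] \<open>\<delta> > 0\<close> by auto
  have sets: "D \<in> sets M" "(\<Union>i. A i) \<in> sets M" using D \<D> A by auto
  have sub: "U n \<subseteq> (\<Union>i. A i)" by (auto simp: U_def)
  have "measure M (((\<Union>i. A i) - D) \<union> (D - (\<Union>i. A i)))
      \<le> measure M (((\<Union>i. A i) - U n) \<union> ((U n - D) \<union> (D - U n)))"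
    using sets U_sets sub by (intro finite_measure_mono) auto
  also have "\<dots> \<le> measure M ((\<Union>i. A i) - U n) + measure M ((U n - D) \<union> (D - U n))"
    using sets U_sets by (intro measure_Un_le) auto
  also have "measure M ((\<Union>i. A i) - U n) = measure M (\<Union>i. A i) - measure M (U n)"
    using sets U_sets sub by (intro finite_measure_Diff) auto
  finally have "measure M (((\<Union>i. A i) - D) \<union> (D - (\<Union>i. A i))) < \<delta>" using D(2) n by linarith
  then show ?thesis using D(1) by blast
qed

text \<open>
  The ambient metric space need not be separable, so its topology may have no countable base; total boundedness of
  \<open>X\<close> supplies finitely many balls of each radius \<open>1 / (n + 1)\<close> that cover \<open>X\<close>.
\<close>
lemma compact_countable_base:
  fixes X :: "'x::metric_space set"
  assumes "compact X"
  obtains \<B> where "countable \<B>" "\<And>B. B \<in> \<B> \<Longrightarrow> open B"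
    "\<And>U. open U \<Longrightarrow> U \<inter> X = \<Union>{B \<inter> X | B. B \<in> \<B> \<and> B \<inter> X \<subseteq> U}"
proof -
  have "\<exists>k. finite k \<and> X \<subseteq> (\<Union>x\<in>k. ball x (1 / real (Suc n)))" for n
    using assms unfolding compact_eq_totally_bounded by simp
  then obtain c where c: "\<And>n. finite (c n)" "\<And>n. X \<subseteq> (\<Union>x\<in>c n. ball x (1 / real (Suc n)))"
    by metis
  define \<B> where "\<B> = (\<Union>n. (\<lambda>x. ball x (1 / real (Suc n))) ` c n)"
  have "countable \<B>" unfolding \<B>_def using c(1) by (auto intro: countable_finite)
  moreover have "open B" if "B \<in> \<B>" for B using that by (auto simp: \<B>_def)
  moreover have "U \<inter> X = \<Union>{B \<inter> X | B. B \<in> \<B> \<and> B \<inter> X \<subseteq> U}" if U: "open U" for U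
  proof (intro equalityI subsetI)
    fix y assume y: "y \<in> U \<inter> X"
    then obtain r where r: "r > 0" "ball y r \<subseteq> U" using U openE by blast
    obtain n where n: "1 / real (Suc n) < r / 2" using nat_approx_posE[of "r / 2"] r by auto
    obtain x where x: "x \<in> c n" "dist x y < 1 / real (Suc n)" using c(2)[of n] y by auto
    have "ball x (1 / real (Suc n)) \<subseteq> ball y r"
    proof
      fix z assume "z \<in> ball x (1 / real (Suc n))"
      then have "dist x z < 1 / real (Suc n)" by simp
      then show "z \<in> ball y r" using n x dist_triangle3[of y z x] by simp
    qed
    then have "ball x (1 / real (Suc n)) \<inter> X \<subseteq> U" using r by blast
    moreover have "ball x (1 / real (Suc n)) \<in> \<B>" using x by (auto simp: \<B>_def)
    moreover have "y \<in> ball x (1 / real (Suc n)) \<inter> X" using x y by auto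
    ultimately show "y \<in> \<Union>{B \<inter> X | B. B \<in> \<B> \<and> B \<inter> X \<subseteq> U}" by blast
  qed auto
  ultimately show ?thesis by (rule that)
qed

context measure_preserving_system
begin

text \<open>
  Events approximable by a countable algebra generated by a base of the topology form a
  \<open>\<sigma>\<close>-algebra that contains the open sets.
\<close>
lemma countable_dense_events:
  "\<exists>\<D>. countable \<D> \<and> \<D> \<noteq> {} \<and> \<D> \<subseteq> sets M \<and>
    (\<forall>A\<in>sets M. \<forall>\<delta>>0. \<exists>D\<in>\<D>. measure M ((A - D) \<union> (D - A)) < \<delta>)"
proof -
  define X where "X = space M"
  have sets_M: "sets M = (\<inter>) X ` sets borel"
    by (simp only: sets_borel sets_restrict_space X_def)
  have "compact X" using compact_space by (simp only: X_def)
  then obtain \<B> where \<B>: "countable \<B>" "\<And>B. B \<in> \<B> \<Longrightarrow> open B"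
    "\<And>U. open U \<Longrightarrow> U \<inter> X = \<Union>{B \<inter> X | B. B \<in> \<B> \<and> B \<inter> X \<subseteq> U}"
    by (rule compact_countable_base) (rule that)
  define G where "G = insert {} ((\<lambda>B. B \<inter> X) ` \<B>)"
  have "countable G" using \<B>(1) by (simp add: G_def)
  have "B \<inter> X \<in> sets M" if "B \<in> \<B>" for B
    using \<B>(2) that unfolding sets_M by (auto simp: Int_commute)
  then have "G \<subseteq> sets M" by (auto simp: G_def)
  obtain \<D> where \<D>: "countable \<D>" "G \<subseteq> \<D>" "\<D> \<subseteq> sets M" "\<And>D. D \<in> \<D> \<Longrightarrow> X - D \<in> \<D>"
    "\<And>D E. D \<in> \<D> \<Longrightarrow> E \<in> \<D> \<Longrightarrow> D \<union> E \<in> \<D>"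
    by (rule countable_subalgebra_containing[OF \<open>countable G\<close> \<open>G \<subseteq> sets M\<close>, folded X_def]) (rule that)
  have empty: "{} \<in> \<D>" using \<D>(2) by (auto simp: G_def)
  have UN: "\<exists>D\<in>\<D>. measure M (((\<Union>i. A i) - D) \<union> (D - (\<Union>i. A i))) < \<delta>"
    if "\<And>i. A i \<in> sets M" "\<And>i \<delta>. \<delta> > 0 \<Longrightarrow> \<exists>D\<in>\<D>. measure M ((A i - D) \<union> (D - A i)) < \<delta>" "\<delta> > 0"
    for A :: "nat \<Rightarrow> 'x set" and \<delta>
    by (rule approximable_UN[of \<D> A]) (fact \<D> empty that)+
  have "\<exists>D\<in>\<D>. measure M ((X \<inter> B - D) \<union> (D - X \<inter> B)) < \<delta>"
    if "B \<in> sigma_sets UNIV (Collect open)" "\<delta> > 0" for B \<delta>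
    using that
  proof (induction arbitrary: \<delta> rule: sigma_sets.induct)
    case (Basic U)
    define \<U> where "\<U> = insert {} {B \<inter> X | B. B \<in> \<B> \<and> B \<inter> X \<subseteq> U}"
    have "\<U> \<subseteq> G" by (auto simp: \<U>_def G_def)
    then have \<U>: "countable \<U>" "\<U> \<noteq> {}" "\<U> \<subseteq> \<D>"
      using countable_subset[OF _ \<open>countable G\<close>] \<D>(2) by (blast, simp add: \<U>_def, blast)
    have "X \<inter> U = \<Union>\<U>" using \<B>(3)[of U] Basic by (auto simp: \<U>_def)
    also have "\<dots> = (\<Union>i. from_nat_into \<U> i)" using \<U> by (simp add: range_from_nat_into)
    finally have XU: "X \<inter> U = (\<Union>i. from_nat_into \<U> i)" .
    have mem: "from_nat_into \<U> i \<in> \<D>" for i by (rule subsetD[OF \<U>(3) from_nat_into[OF \<U>(2)]])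
    have mem_sets: "from_nat_into \<U> i \<in> sets M" for i by (rule subsetD[OF \<D>(3) mem])
    have self: "\<exists>D\<in>\<D>. measure M ((from_nat_into \<U> i - D) \<union> (D - from_nat_into \<U> i)) < \<delta>'"
      if "\<delta>' > 0" for i \<delta>'
      by (rule bexI[OF _ mem[of i]]) (simp only: Diff_cancel Un_empty_left measure_empty that)
    show ?case unfolding XU by (rule UN) (fact mem_sets self \<open>\<delta> > 0\<close>)+
  next
    case Empty
    then show ?case by (intro bexI[OF _ empty]) simp
  next
    case (Compl B)
    then obtain D where D: "D \<in> \<D>" "measure M ((X \<inter> B - D) \<union> (D - X \<inter> B)) < \<delta>" by blast
    have "D \<subseteq> X" unfolding X_def by (rule sets.sets_into_space[OF subsetD[OF \<D>(3) D(1)]])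
    then have "(X \<inter> (UNIV - B) - (X - D)) \<union> ((X - D) - X \<inter> (UNIV - B)) = (X \<inter> B - D) \<union> (D - X \<inter> B)"
      by blast
    then show ?case using D(2) by (intro bexI[OF _ \<D>(4)[OF D(1)]]) (simp only:)
  next
    case (Union B)
    have eq: "X \<inter> \<Union> (range B) = (\<Union>i. X \<inter> B i)" by auto
    have "B i \<in> sets borel" for i using Union.hyps[of i] by (simp add: borel_def)
    then have "X \<inter> B i \<in> sets M" for i unfolding sets_M by (rule imageI)
    then show ?case unfolding eq by (rule UN) (fact \<open>\<And>i. X \<inter> B i \<in> sets M\<close> Union.IH \<open>\<delta> > 0\<close>)+
  qed
  then have "\<exists>D\<in>\<D>. measure M ((A - D) \<union> (D - A)) < \<delta>" if "A \<in> sets M" "\<delta> > 0" for A \<delta>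
    using that unfolding sets_M by (auto simp: borel_def)
  moreover have "\<D> \<noteq> {}" using empty by blast
  ultimately show ?thesis using \<D>(1,3) by (intro exI[of _ \<D>] conjI ballI allI impI)
qed

text \<open>
  The bound does not depend on the translations \<open>h j\<close>, which is why approximating the events once controls
  the correlations for all \<open>\<alpha>\<close> simultaneously.
\<close>
lemma measure_INT_perturb:
  assumes "finite J" "J \<noteq> {}" and A: "\<And>j. j \<in> J \<Longrightarrow> A j \<in> sets M" and D: "\<And>j. j \<in> J \<Longrightarrow> D j \<in> sets M"
  shows "\<bar>measure M (\<Inter>j\<in>J. T (h j) ` A j) - measure M (\<Inter>j\<in>J. T (h j) ` D j)\<bar>
    \<le> (\<Sum>j\<in>J. measure M ((A j - D j) \<union> (D j - A j)))"
proof -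
  define \<Delta> where "\<Delta> j = (A j - D j) \<union> (D j - A j)" for j
  have \<Delta>: "\<Delta> j \<in> sets M" if "j \<in> J" for j using A D that by (auto simp: \<Delta>_def)
  let ?A = "\<Inter>j\<in>J. T (h j) ` A j" and ?D = "\<Inter>j\<in>J. T (h j) ` D j"
  have sets: "?A \<in> sets M" "?D \<in> sets M" using A D assms(1,2) by (auto intro!: sets.finite_INT)
  have "(?A - ?D) \<union> (?D - ?A) \<subseteq> (\<Union>j\<in>J. T (h j) ` \<Delta> j)"
    by (fastforce simp: \<Delta>_def)
  then have "measure M ((?A - ?D) \<union> (?D - ?A)) \<le> measure M (\<Union>j\<in>J. T (h j) ` \<Delta> j)"
    using \<Delta> assms(1) by (intro finite_measure_mono) auto
  also have "\<dots> \<le> (\<Sum>j\<in>J. measure M (T (h j) ` \<Delta> j))"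
    using \<Delta> assms(1) by (intro measure_UNION_le) auto
  also have "\<dots> = (\<Sum>j\<in>J. measure M (\<Delta> j))" using \<Delta> by simp
  finally show ?thesis
    using measure_diff_le_sym_diff[OF sets] by (simp add: \<Delta>_def)
qed

section \<open>Limits along an infinite set of indices\<close>

text \<open>
  The conditions "error less than \<open>1 / (n + 1)\<close> for the tuple \<open>D\<close> of events from the dense family" are
  countable in number, so one set \<open>S\<close> meets each of them eventually; approximation extends this to
  all tuples of events.
\<close>
theorem mixing_R_lim:
  fixes g :: "'i \<Rightarrow> nat \<Rightarrow> nat \<Rightarrow> 'g"
  assumes mix: "strongly_mixing M T"
    and J: "finite J" "card J = Suc m" and "m \<ge> 1"
    and distinct: "\<And>i j. i \<in> J \<Longrightarrow> j \<in> J \<Longrightarrow> i \<noteq> j \<Longrightarrow> essentially_distinct m (g i) (g j)"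
  shows "\<exists>S. infinite S \<and> (\<forall>A. (\<forall>j\<in>J. A j \<in> sets M) \<longrightarrow>
    R_lim m S (\<lambda>\<alpha>. measure M (\<Inter>j\<in>J. T (sum_along m (g j) \<alpha>) ` A j)) (\<Prod>j\<in>J. measure M (A j)))"
proof -
  obtain \<D> where \<D>: "countable \<D>" "\<D> \<noteq> {}" "\<D> \<subseteq> sets M"
    "\<And>A \<delta>. A \<in> sets M \<Longrightarrow> \<delta> > 0 \<Longrightarrow> \<exists>D\<in>\<D>. measure M ((A - D) \<union> (D - A)) < \<delta>"
    using countable_dense_events by metis
  define dev where "dev A \<alpha> = \<bar>measure M (\<Inter>j\<in>J. T (sum_along m (g j) \<alpha>) ` A j) - (\<Prod>j\<in>J. measure M (A j))\<bar>" for A \<alpha>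
  define I where "I = (J \<rightarrow>\<^sub>E \<D>) \<times> (UNIV :: nat set)"
  have I: "countable I" "I \<noteq> {}"
    using \<D>(1,2) J(1) by (auto simp: I_def PiE_eq_empty_iff intro!: countable_PiE)
  define P where "P i \<alpha> = (case from_nat_into I i of (D, n) \<Rightarrow> dev D \<alpha> < 1 / real (Suc n))" for i \<alpha>
  have "\<exists>\<alpha>\<in>nsets S m. P i \<alpha>" if "infinite S" for i S
  proof -
    obtain D n where Dn: "from_nat_into I i = (D, n)" by fastforce
    then have "D \<in> J \<rightarrow>\<^sub>E \<D>" using from_nat_into[OF I(2), of i] by (auto simp: I_def)
    then have D: "D j \<in> sets M" if "j \<in> J" for j using that \<D>(3) by auto
    have "1 / real (Suc n) > 0" by simp
    from mixing_along_sums[OF mix J distinct D this that]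
    show ?thesis by (simp add: P_def dev_def Dn)
  qed
  then obtain S where S: "infinite S" "\<And>i. \<exists>n. \<forall>\<alpha>\<in>nsets S m. (\<forall>x\<in>\<alpha>. n < x) \<longrightarrow> P i \<alpha>"
    using homogeneous_countable_conditions[of m P] by metis
  have "R_lim m S (\<lambda>\<alpha>. measure M (\<Inter>j\<in>J. T (sum_along m (g j) \<alpha>) ` A j)) (\<Prod>j\<in>J. measure M (A j))"
    if A: "\<forall>j\<in>J. A j \<in> sets M" for A
    unfolding R_lim_def
  proof (intro allI impI)
    fix \<epsilon> :: real assume "\<epsilon> > 0"
    define \<zeta> where "\<zeta> = \<epsilon> / (4 * Suc m)"
    have "\<zeta> > 0" using \<open>\<epsilon> > 0\<close> by (simp add: \<zeta>_def)
    then have "\<forall>j\<in>J. \<exists>D\<in>\<D>. measure M ((A j - D) \<union> (D - A j)) < \<zeta>" using A \<D>(4) by blast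
    then obtain D0 where D0: "\<And>j. j \<in> J \<Longrightarrow> D0 j \<in> \<D>"
        "\<And>j. j \<in> J \<Longrightarrow> measure M ((A j - D0 j) \<union> (D0 j - A j)) < \<zeta>"
      by metis
    define D where "D = restrict D0 J"
    have D: "D \<in> J \<rightarrow>\<^sub>E \<D>" "\<And>j. j \<in> J \<Longrightarrow> D j \<in> sets M"
        "\<And>j. j \<in> J \<Longrightarrow> measure M ((A j - D j) \<union> (D j - A j)) < \<zeta>"
      using D0 \<D>(3) by (auto simp: D_def)
    have total: "(\<Sum>j\<in>J. measure M ((A j - D j) \<union> (D j - A j))) \<le> \<epsilon> / 4"
    proof -
      have "(\<Sum>j\<in>J. measure M ((A j - D j) \<union> (D j - A j))) \<le> of_nat (card J) * \<zeta>"
        using D(3) by (intro sum_bounded_above) (auto intro: less_imp_le)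
      also have "\<dots> = \<epsilon> / 4" unfolding J(2) \<zeta>_def by (simp add: field_simps)
      finally show ?thesis .
    qed
    obtain n where n: "1 / real (Suc n) < \<epsilon> / 4" using nat_approx_posE[of "\<epsilon> / 4"] \<open>\<epsilon> > 0\<close> by auto
    have "(D, n) \<in> I" using D(1) by (simp add: I_def)
    then obtain i where i: "from_nat_into I i = (D, n)"
      using I(1) from_nat_into_surj by metis
    obtain N where N: "\<And>\<alpha>. \<alpha> \<in> nsets S m \<Longrightarrow> \<forall>x\<in>\<alpha>. N < x \<Longrightarrow> P i \<alpha>" using S(2)[of i] by blast
    show "\<exists>\<alpha>0\<in>nsets UNIV m. \<forall>\<alpha>\<in>nsets S m. Max \<alpha>0 < Min \<alpha> \<longrightarrow>
        dist (measure M (\<Inter>j\<in>J. T (sum_along m (g j) \<alpha>) ` A j)) (\<Prod>j\<in>J. measure M (A j)) < \<epsilon>"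
    proof (intro bexI[of _ "{N..<N + m}"] ballI impI)
      show "{N..<N + m} \<in> nsets UNIV m" by (simp add: nsets_def)
      fix \<alpha> assume \<alpha>: "\<alpha> \<in> nsets S m" and late: "Max {N..<N + m} < Min \<alpha>"
      have "N \<le> Max {N..<N + m}" using \<open>m \<ge> 1\<close> by (intro Max_ge) auto
      moreover have "Min \<alpha> \<le> x" if "x \<in> \<alpha>" for x using \<alpha> that by (intro Min_le) (auto simp: nsets_def)
      ultimately have "\<forall>x\<in>\<alpha>. N < x" using late by fastforce
      then have "dev D \<alpha> < \<epsilon> / 4" using N[OF \<alpha>] n by (simp add: P_def i)
      moreover have "\<bar>measure M (\<Inter>j\<in>J. T (sum_along m (g j) \<alpha>) ` A j)
          - measure M (\<Inter>j\<in>J. T (sum_along m (g j) \<alpha>) ` D j)\<bar> \<le> \<epsilon> / 4"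
        by (rule order_trans[OF measure_INT_perturb total]) (use A D J in auto)
      moreover have "\<bar>(\<Prod>j\<in>J. measure M (A j)) - (\<Prod>j\<in>J. measure M (D j))\<bar> \<le> \<epsilon> / 4"
      proof -
        have "\<bar>(\<Prod>j\<in>J. measure M (A j)) - (\<Prod>j\<in>J. measure M (D j))\<bar>
            \<le> (\<Sum>j\<in>J. \<bar>measure M (A j) - measure M (D j)\<bar>)"
          using norm_prod_diff[of J "\<lambda>j. measure M (A j)" "\<lambda>j. measure M (D j)"] by simp
        also have "\<dots> \<le> (\<Sum>j\<in>J. measure M ((A j - D j) \<union> (D j - A j)))"
          using A D by (intro sum_mono measure_diff_le_sym_diff) auto
        finally show ?thesis using total by linarith
      qed
      ultimately show "dist (measure M (\<Inter>j\<in>J. T (sum_along m (g j) \<alpha>) ` A j)) (\<Prod>j\<in>J. measure M (A j)) < \<epsilon>"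
        using \<open>\<epsilon> > 0\<close> unfolding dev_def dist_real_def by linarith
    qed
  qed
  then show ?thesis using S(1) by blast
qed

section \<open>Correlations of two sets along sums\<close>

definition mixing_on_sums :: "nat \<Rightarrow> bool" where
  "mixing_on_sums m \<longleftrightarrow> (\<forall>g. non_degenerated m g \<longrightarrow> (\<forall>A0\<in>sets M. \<forall>A1\<in>sets M. \<forall>\<epsilon>>0.
    \<exists>\<alpha>\<in>nsets UNIV m. \<bar>measure M (A0 \<inter> T (sum_along m g \<alpha>) ` A1) - measure M A0 * measure M A1\<bar> < \<epsilon>))"

text \<open>
  Restricting the indices to \<open>S\<close> means passing to a subsequence, which is again non-degenerated.
  This form allows Ramsey's theorem to be applied.
\<close>
lemma mixing_on_sums_infinite:
  assumes W: "mixing_on_sums m" and g: "non_degenerated m g"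
    and A: "A0 \<in> sets M" "A1 \<in> sets M" and "\<epsilon> > 0" and S: "infinite S"
  shows "\<exists>\<alpha>\<in>nsets S m. \<bar>measure M (A0 \<inter> T (sum_along m g \<alpha>) ` A1) - measure M A0 * measure M A1\<bar> < \<epsilon>"
proof -
  define e where "e = enumerate S"
  have e: "strict_mono e" "range e = S" using S by (auto simp: e_def strict_mono_enumerate range_enumerate)
  have "non_degenerated m (\<lambda>k. g (e k))"
    using g filterlim_compose[OF _ filterlim_subseq[OF e(1)]] by (auto simp: non_degenerated_def)
  then obtain \<alpha> where \<alpha>: "\<alpha> \<in> nsets UNIV m"
    "\<bar>measure M (A0 \<inter> T (sum_along m (\<lambda>k. g (e k)) \<alpha>) ` A1) - measure M A0 * measure M A1\<bar> < \<epsilon>"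
    using W A \<open>\<epsilon> > 0\<close> unfolding mixing_on_sums_def by blast
  have "e ` \<alpha> \<in> nsets S m"
    using \<alpha>(1) e card_image[OF inj_on_subset[OF strict_mono_imp_inj_on[OF e(1)] subset_UNIV]]
    by (auto simp: nsets_def)
  then show ?thesis using \<alpha>(2) by (auto simp: sum_along_subsequence[OF e(1) \<alpha>(1)])
qed

text \<open>
  The first \<open>n\<close> indices are frozen at \<open>0, \<dots>, n - 1\<close>. They contribute a constant \<open>c\<close>, which is absorbed by
  replacing \<open>A1\<close> by its translate.
\<close>
lemma mixing_on_sums_add:
  assumes W: "mixing_on_sums m"
  shows "mixing_on_sums (n + m)"
  unfolding mixing_on_sums_def
proof (intro allI impI ballI)
  fix g :: "nat \<Rightarrow> nat \<Rightarrow> 'g" and A0 A1 and \<epsilon> :: real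
  assume g: "non_degenerated (n + m) g" and A: "A0 \<in> sets M" "A1 \<in> sets M" and \<epsilon>: "\<epsilon> > 0"
  define c where "c = sum_along n g {..<n}"
  have "non_degenerated m (\<lambda>k t. g k (n + t))" using g by (auto simp: non_degenerated_def)
  from mixing_on_sums_infinite[OF W this A(1) T_image_sets[OF A(2)] \<epsilon> infinite_Ici, of n c]
  obtain \<beta> where \<beta>: "\<beta> \<in> nsets {n..} m"
    "\<bar>measure M (A0 \<inter> T (sum_along m (\<lambda>k t. g k (n + t)) \<beta>) ` T c ` A1) - measure M A0 * measure M (T c ` A1)\<bar> < \<epsilon>"
    by blast
  have later: "x < y" if "x \<in> {..<n}" "y \<in> \<beta>" for x y using \<beta>(1) that by (force simp: nsets_def)
  have init: "{..<n} \<in> nsets UNIV n" by (simp add: nsets_def)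
  have "{..<n} \<union> \<beta> \<in> nsets UNIV (n + m)"
    using \<beta>(1) later by (auto simp: nsets_def intro!: card_Un_disjoint[THEN trans])
  moreover have "sum_along (n + m) g ({..<n} \<union> \<beta>) = sum_along m (\<lambda>k t. g k (n + t)) \<beta> + c"
    using sum_along_Un[OF init \<beta>(1) later] by (simp add: c_def add.commute)
  ultimately show "\<exists>\<alpha>\<in>nsets UNIV (n + m).
      \<bar>measure M (A0 \<inter> T (sum_along (n + m) g \<alpha>) ` A1) - measure M A0 * measure M A1\<bar> < \<epsilon>"
    using \<beta>(2) A by (metis T_image_image measure_T_image sets.sets_into_space)
qed

text \<open>
  The analogue for sums of the fact that a bounded sequence of vectors in Hilbert space
  with vanishing pairwise correlations converges weakly to zero. The sequence \<open>g'\<close> lists \<open>- g\<close> followed by \<open>g\<close>, so that a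
  \<open>2m\<close>-fold sum along \<open>g'\<close> over two blocks is the difference of the \<open>m\<close>-fold sums over the blocks.
\<close>
lemma mixing_on_sums_halve:
  assumes W: "mixing_on_sums (m + m)"
  shows "mixing_on_sums m"
  unfolding mixing_on_sums_def
proof (intro allI impI ballI)
  fix g :: "nat \<Rightarrow> nat \<Rightarrow> 'g" and A0 A1 and \<epsilon> :: real
  assume g: "non_degenerated m g" and A: "A0 \<in> sets M" "A1 \<in> sets M" and \<epsilon>: "\<epsilon> > 0"
  define g' where "g' k t = (if t \<le> m then - g k t else g k (t - m))" for k t
  define \<eta> where "\<eta> = \<epsilon>\<^sup>2 / 10"
  have \<eta>: "\<eta> > 0" "8 * \<eta> < \<epsilon>\<^sup>2" using \<epsilon> by (auto simp: \<eta>_def)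
  obtain N :: nat where "2 / \<epsilon>\<^sup>2 \<le> real N" using real_arch_simple by blast
  then have N: "2 \<le> real N * \<epsilon>\<^sup>2" using \<epsilon> by (simp add: divide_le_eq)
  have "inj (uminus :: 'g \<Rightarrow> 'g)" by simp
  have g': "non_degenerated (m + m) g'"
    unfolding non_degenerated_def
  proof
    fix t assume t: "t \<in> {1..m + m}"
    show "filterlim (\<lambda>k. g' k t) cofinite sequentially"
    proof (cases "t \<le> m")
      case True
      then have "filterlim (\<lambda>k. g k t) cofinite sequentially"
        using g t by (auto simp: non_degenerated_def)
      from filterlim_compose[OF filterlim_inj_cofinite[OF \<open>inj uminus\<close>] this]
      show ?thesis using True by (simp add: g'_def)
    next
      case False
      then have "t - m \<in> {1..m}" using t by auto
      then show ?thesis using g False by (simp add: g'_def non_degenerated_def)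
    qed
  qed
  define good where "good \<gamma> \<longleftrightarrow>
    \<bar>measure M (A1 \<inter> T (sum_along (m + m) g' \<gamma>) ` A1) - measure M A1 * measure M A1\<bar> < \<eta>" for \<gamma>
  obtain S where S: "infinite S" "\<And>\<gamma>. \<gamma> \<in> nsets S (m + m) \<Longrightarrow> good \<gamma>"
    using homogeneous_finite_conditions[of "{()}" "m + m" "\<lambda>_. good" UNIV]
      mixing_on_sums_infinite[OF W g' A(2) A(2) \<eta>(1)] by (auto simp: good_def)
  define e where "e = enumerate S"
  have e: "strict_mono e" "range e = S" using S by (auto simp: e_def strict_mono_enumerate range_enumerate)
  \<comment> \<open>Successive blocks of \<open>m\<close> elements of \<open>S\<close>.\<close>
  define \<alpha> where "\<alpha> i = e ` {i * m..<i * m + m}" for i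
  have \<alpha>: "\<alpha> i \<in> nsets S m" for i
    using e card_image[OF inj_on_subset[OF strict_mono_imp_inj_on[OF e(1)] subset_UNIV]]
    by (auto simp: \<alpha>_def nsets_def)
  have later: "x < y" if "i < i'" "x \<in> \<alpha> i" "y \<in> \<alpha> i'" for i i' x y
  proof -
    obtain a b where ab: "x = e a" "y = e b" "a < i * m + m" "i' * m \<le> b" using \<open>x \<in> \<alpha> i\<close> \<open>y \<in> \<alpha> i'\<close> unfolding \<alpha>_def by fastforce
    have "Suc i * m \<le> i' * m" using that by (intro mult_le_mono1) simp
    then have "a < b" using ab by simp
    then show ?thesis using ab e(1) by (simp add: strict_mono_less)
  qed
  define s where "s i = sum_along m g (\<alpha> i)" for i
  have sub: "A1 \<subseteq> space M" using A sets.sets_into_space by blast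
  have pair: "\<bar>measure M (T (s i) ` A1 \<inter> T (s i') ` A1) - (measure M A1)\<^sup>2\<bar> \<le> \<eta>" if "i < i'" for i i'
  proof -
    have "\<alpha> i \<inter> \<alpha> i' = {}" using later[OF that] by blast
    then have "\<alpha> i \<union> \<alpha> i' \<in> nsets S (m + m)"
      using \<alpha>[of i] \<alpha>[of i'] by (auto simp: nsets_def card_Un_disjoint)
    moreover have "sum_along (m + m) g' (\<alpha> i \<union> \<alpha> i') = - s i + s i'"
    proof -
      have "sum_along m g' (\<alpha> i) = - s i"
        unfolding s_def sum_along_def sum_negf[symmetric] by (intro sum.cong) (auto simp: g'_def)
      moreover have "sum_along m (\<lambda>k t. g' k (m + t)) (\<alpha> i') = s i'"
        unfolding s_def sum_along_def by (intro sum.cong) (auto simp: g'_def)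
      ultimately show ?thesis using sum_along_Un[OF \<alpha>[of i] \<alpha>[of i'] later[OF that], of g'] by simp
    qed
    ultimately have "\<bar>measure M (A1 \<inter> T (- s i + s i') ` A1) - (measure M A1)\<^sup>2\<bar> < \<eta>"
      using S(2)[of "\<alpha> i \<union> \<alpha> i'"] by (simp add: good_def power2_eq_square)
    moreover have "T (s i) ` (A1 \<inter> T (- s i + s i') ` A1) = T (s i) ` A1 \<inter> T (s i') ` A1"
      by (simp add: T_image_Int[OF sub T_image_subset[OF sub]] T_image_image[OF sub])
    moreover have "measure M (T (s i) ` (A1 \<inter> T (- s i + s i') ` A1)) = measure M (A1 \<inter> T (- s i + s i') ` A1)"
      using A by (intro measure_T_image) auto
    ultimately show ?thesis by simp
  qed
  have "\<exists>i\<in>{..<N}. \<bar>measure M (A0 \<inter> T (s i) ` A1) - measure M A0 * measure M A1\<bar> < \<epsilon>"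
  proof (rule nearly_independent_events_meet[where \<eta> = \<eta>])
    show "\<bar>measure M (T (s i) ` A1 \<inter> T (s i') ` A1) - (measure M A1)\<^sup>2\<bar> \<le> \<eta>" if "i \<noteq> i'" for i i'
      using pair[of i i'] pair[of i' i] that by (cases i i' rule: linorder_cases) (auto simp: Int_commute)
  qed (use A N \<eta> \<epsilon> in auto)
  then show "\<exists>\<alpha>\<in>nsets UNIV m. \<bar>measure M (A0 \<inter> T (sum_along m g \<alpha>) ` A1) - measure M A0 * measure M A1\<bar> < \<epsilon>"
    using \<alpha> nsets_mono[OF subset_UNIV, of S m] unfolding s_def by blast
qed

text \<open>
  A failure of mixing yields infinitely many bad group elements, and any injective enumeration of
  them tends to infinity.
\<close>
lemma mixing_on_sums_1: "mixing_on_sums 1 \<longleftrightarrow> strongly_mixing M T"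
proof
  have single: "sum_along 1 g {k} = g k 1" for g :: "nat \<Rightarrow> nat \<Rightarrow> 'g" and k
    by (simp add: sum_along_def)
  show "strongly_mixing M T" if W: "mixing_on_sums 1"
    unfolding strongly_mixing_def
  proof (intro ballI tendstoI, rule ccontr)
    fix A0 A1 and \<epsilon> :: real assume A: "A0 \<in> sets M" "A1 \<in> sets M" and "\<epsilon> > 0"
    let ?bad = "{g. \<not> dist (measure M (A0 \<inter> T g ` A1)) (measure M A0 * measure M A1) < \<epsilon>}"
    assume "\<not> (\<forall>\<^sub>F g in cofinite. dist (measure M (A0 \<inter> T g ` A1)) (measure M A0 * measure M A1) < \<epsilon>)"
    then have "infinite ?bad" by (simp add: eventually_cofinite)
    then obtain u :: "nat \<Rightarrow> 'g" where u: "inj u" "range u \<subseteq> ?bad"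
      using infinite_countable_subset by blast
    have "non_degenerated 1 (\<lambda>k t. u k)"
      using filterlim_inj_cofinite[OF u(1)] by (simp add: non_degenerated_def cofinite_eq_sequentially)
    then obtain \<alpha> where \<alpha>: "\<alpha> \<in> nsets UNIV 1"
      "\<bar>measure M (A0 \<inter> T (sum_along 1 (\<lambda>k t. u k) \<alpha>) ` A1) - measure M A0 * measure M A1\<bar> < \<epsilon>"
      using W A \<open>\<epsilon> > 0\<close> unfolding mixing_on_sums_def by blast
    obtain k where "\<alpha> = {k}" using \<alpha>(1) by (auto simp: nsets_def card_1_singleton_iff)
    then have "u k \<notin> ?bad" using \<alpha>(2) by (simp add: sum_along_def dist_real_def)
    then show False using u(2) by blast
  qed
  show "mixing_on_sums 1" if mix: "strongly_mixing M T"
    unfolding mixing_on_sums_def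
  proof (intro allI impI ballI)
    fix g :: "nat \<Rightarrow> nat \<Rightarrow> 'g" and A0 A1 and \<epsilon> :: real
    assume g: "non_degenerated 1 g" and A: "A0 \<in> sets M" "A1 \<in> sets M" and \<epsilon>: "\<epsilon> > 0"
    have "filterlim (\<lambda>k. g k 1) cofinite sequentially" using g by (simp add: non_degenerated_def)
    from tendstoD[OF mixing_tendsto[OF mix this A] \<epsilon>]
    obtain k where k: "\<bar>measure M (A0 \<inter> T (g k 1) ` A1) - measure M A0 * measure M A1\<bar> < \<epsilon>"
      unfolding dist_real_def eventually_sequentially by blast
    have "{k} \<in> nsets UNIV 1" by (simp add: nsets_def)
    then show "\<exists>\<alpha>\<in>nsets UNIV 1. \<bar>measure M (A0 \<inter> T (sum_along 1 g \<alpha>) ` A1) - measure M A0 * measure M A1\<bar> < \<epsilon>"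
      using k by (intro bexI[of _ "{k}"]) (simp_all only: single)
  qed
qed

text \<open>
  The downward step uses \<open>m + 1 \<le> m + m\<close> to pass from \<open>m + 1\<close> up to \<open>2m\<close> and then halves.
\<close>
theorem mixing_on_sums_iff:
  assumes "m \<ge> 1"
  shows "mixing_on_sums m \<longleftrightarrow> strongly_mixing M T"
proof
  show "strongly_mixing M T" if "mixing_on_sums m"
    using assms that
  proof (induction m rule: nat_induct_at_least)
    case base
    then show ?case by (simp only: mixing_on_sums_1)
  next
    case (Suc m)
    have "mixing_on_sums (m + m)"
      using mixing_on_sums_add[OF Suc.prems, of "m - 1"] Suc.hyps by simp
    then show ?case using mixing_on_sums_halve Suc.IH by blast
  qed
  show "mixing_on_sums m" if "strongly_mixing M T"
    using mixing_on_sums_add[of 1 "m - 1"] that assms by (simp add: mixing_on_sums_1[simplified])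
qed

text \<open>
  The elements of a \<open>\<Sigma>\<^sub>m\<close> set are the sums along the \<open>m\<close>-element index sets, and \<open>mixing_on_sums\<close>
  says that one of them is good.
\<close>
lemma mixing_on_sums_iff_Sigma_star:
  "mixing_on_sums m \<longleftrightarrow> (\<forall>\<epsilon>>0. \<forall>A0\<in>sets M. \<forall>A1\<in>sets M.
     Sigma_star m {g. \<bar>measure M (A0 \<inter> T g ` A1) - measure M A0 * measure M A1\<bar> < \<epsilon>})"
    (is "_ \<longleftrightarrow> ?Sigma")
proof
  assume W: "mixing_on_sums m"
  show ?Sigma
    unfolding Sigma_star_def Sigma_set_def tilde_Sigma_def
  proof (intro allI impI ballI, elim exE conjE)
    fix \<epsilon> :: real and A0 A1 E and g :: "nat \<Rightarrow> nat \<Rightarrow> nat \<Rightarrow> 'g"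
    assume "\<epsilon> > 0" and A: "A0 \<in> sets M" "A1 \<in> sets M"
      and g: "\<forall>j\<in>{1..m}. non_degenerated 1 (g j) \<and>
        (\<forall>t\<in>{1..1}. \<forall>t'\<in>{1..1}. t \<noteq> t' \<longrightarrow> grow_apart (\<lambda>k. g j k t) (\<lambda>k. g j k t'))"
      and E: "(\<lambda>x. \<lambda>t\<in>{1..1}. x) ` E
        = {\<lambda>t\<in>{1..1}. \<Sum>j=1..m. g j (k j) t | k. strict_mono_on {1..m} k}"
    have "non_degenerated m (\<lambda>k t. g t k 1)" using g by (auto simp: non_degenerated_def)
    then obtain \<alpha> where \<alpha>: "\<alpha> \<in> nsets UNIV m"
      "\<bar>measure M (A0 \<inter> T (sum_along m (\<lambda>k t. g t k 1) \<alpha>) ` A1) - measure M A0 * measure M A1\<bar> < \<epsilon>"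
      using W A \<open>\<epsilon> > 0\<close> unfolding mixing_on_sums_def by blast
    obtain k where k: "strict_mono_on {1..m} k" "\<alpha> = k ` {1..m}"
      using \<alpha>(1) unfolding nsets_eq_strict_mono_image by auto
    have "(\<lambda>t\<in>{1..1}. \<Sum>j=1..m. g j (k j) t) \<in> (\<lambda>x. \<lambda>t\<in>{1..1}. x) ` E"
      unfolding E using k(1) by blast
    then obtain x where x: "x \<in> E" "(\<lambda>t\<in>{1..1}. \<Sum>j=1..m. g j (k j) t) = (\<lambda>t\<in>{1..1::nat}. x)"
      by blast
    from fun_cong[OF x(2), of 1] have "sum_along m (\<lambda>k t. g t k 1) \<alpha> = x"
      unfolding k(2) sum_along_strict_mono[OF k(1)] by simp
    then show "{g. \<bar>measure M (A0 \<inter> T g ` A1) - measure M A0 * measure M A1\<bar> < \<epsilon>} \<inter> E \<noteq> {}"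
      using x(1) \<alpha>(2) by blast
  qed
next
  assume R: ?Sigma
  show "mixing_on_sums m"
    unfolding mixing_on_sums_def
  proof (intro allI impI ballI)
    fix g :: "nat \<Rightarrow> nat \<Rightarrow> 'g" and A0 A1 and \<epsilon> :: real
    assume g: "non_degenerated m g" and A: "A0 \<in> sets M" "A1 \<in> sets M" and \<epsilon>: "\<epsilon> > 0"
    define E where "E = {sum_along m g \<alpha> | \<alpha>. \<alpha> \<in> nsets UNIV m}"
    have "E = {\<Sum>j=1..m. g (k j) j | k. strict_mono_on {1..m} k}"
      unfolding E_def nsets_eq_strict_mono_image by (force simp: sum_along_strict_mono[simplified])
    then have "(\<lambda>x. \<lambda>t\<in>{1..1}. x) ` E
        = {\<lambda>t\<in>{1..1}. \<Sum>j=1..m. g (k j) j | k. strict_mono_on {1..m} k}"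
      by blast
    moreover have "\<forall>j\<in>{1..m}. non_degenerated 1 (\<lambda>k t. g k j) \<and>
        (\<forall>t\<in>{1..1}. \<forall>t'\<in>{1..1::nat}. t \<noteq> t' \<longrightarrow> grow_apart (\<lambda>k. g k j) (\<lambda>k. g k j))"
      using g by (auto simp: non_degenerated_def)
    ultimately have "Sigma_set m E"
      unfolding Sigma_set_def tilde_Sigma_def by (intro exI[of _ "\<lambda>j k t. g k j"] conjI)
    moreover have "Sigma_star m {g. \<bar>measure M (A0 \<inter> T g ` A1) - measure M A0 * measure M A1\<bar> < \<epsilon>}"
      using R A \<epsilon> by blast
    ultimately have "{g. \<bar>measure M (A0 \<inter> T g ` A1) - measure M A0 * measure M A1\<bar> < \<epsilon>} \<inter> E \<noteq> {}"
      unfolding Sigma_star_def by blast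
    then show "\<exists>\<alpha>\<in>nsets UNIV m. \<bar>measure M (A0 \<inter> T (sum_along m g \<alpha>) ` A1) - measure M A0 * measure M A1\<bar> < \<epsilon>"
      unfolding E_def by blast
  qed
qed

section \<open>Reduction of many sets to two\<close>

lemma INT_orbit_insert_0:
  fixes A :: "nat \<Rightarrow> 'x set" and h :: "nat \<Rightarrow> 'g"
  assumes "A 0 \<subseteq> space M" "h 0 = 0"
  shows "(\<Inter>j\<in>{0..l}. T (h j) ` A j) = A 0 \<inter> (\<Inter>j\<in>{1..l}. T (h j) ` A j)"
proof -
  have "{0..l} = insert 0 {1..l}" by auto
  then show ?thesis using assms by (simp add: T_image_zero)
qed

text \<open>
  Sets equal to the whole space disappear from a correlation, which therefore only sees \<open>A0\<close> and \<open>A1\<close>.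
\<close>
lemma two_set_correlation:
  fixes l :: nat and h :: "nat \<Rightarrow> 'g"
  assumes "l \<ge> 1" "A0 \<in> sets M" "A1 \<in> sets M"
  defines "A \<equiv> \<lambda>j. if j = 0 then A0 else if j = 1 then A1 else space M"
  shows "A j \<in> sets M"
    and "A 0 \<inter> (\<Inter>j\<in>{1..l}. T (h j) ` A j) = A0 \<inter> T (h 1) ` A1"
    and "(\<Prod>j=0..l. measure M (A j)) = measure M A0 * measure M A1"
proof -
  have split: "{1..l} = insert 1 {2..l}" "{0..l} = insert 0 (insert 1 {2..l})"
    using \<open>l \<ge> 1\<close> by auto
  have sub: "A0 \<subseteq> space M" using assms sets.sets_into_space by blast
  show "A j \<in> sets M" using assms by auto
  have "(\<Inter>j\<in>{2..l}. T (h j) ` A j) = (\<Inter>j\<in>{2..l}. space M)"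
    by (intro INF_cong) (auto simp: A_def T_image_space)
  then have "A0 \<inter> (\<Inter>j\<in>{2..l}. T (h j) ` A j) = A0" using sub by auto
  then show "A 0 \<inter> (\<Inter>j\<in>{1..l}. T (h j) ` A j) = A0 \<inter> T (h 1) ` A1"
    unfolding split(1) INT_insert by (auto simp: A_def)
  have "(\<Prod>j\<in>{2..l}. measure M (A j)) = 1"
    by (intro prod.neutral) (auto simp: A_def prob_space)
  then show "(\<Prod>j=0..l. measure M (A j)) = measure M A0 * measure M A1"
    unfolding split(2) by (simp add: A_def)
qed

text \<open>
  The extension is carried out separately for each position \<open>j\<close>. The double sequence \<open>v\<close> can be
  read in two ways: \<open>i\<close> numbers the sequences when \<open>j\<close> is the coordinate, and \<open>i\<close> is the
  coordinate when \<open>j\<close> numbers the summands.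
\<close>
lemma extend_to_grow_apart_family:
  fixes g :: "nat \<Rightarrow> nat \<Rightarrow> 'g" and d :: nat
  assumes g: "non_degenerated m g" and "d \<ge> 1"
  obtains v where "\<And>j k. j \<in> {1..m} \<Longrightarrow> v j 1 k = g k j"
    "\<And>j i. j \<in> {1..m} \<Longrightarrow> i \<in> {1..d} \<Longrightarrow> filterlim (v j i) cofinite sequentially"
    "\<And>j i i'. j \<in> {1..m} \<Longrightarrow> i \<in> {1..d} \<Longrightarrow> i' \<in> {1..d} \<Longrightarrow> i \<noteq> i' \<Longrightarrow> grow_apart (v j i) (v j i')"
proof -
  have "\<forall>j\<in>{1..m}. \<exists>v. v 1 = (\<lambda>k. g k j) \<and> (\<forall>i\<in>{1..d}. filterlim (v i) cofinite sequentially) \<and>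
      (\<forall>i\<in>{1..d}. \<forall>i'\<in>{1..d}. i \<noteq> i' \<longrightarrow> grow_apart (v i) (v i'))"
  proof
    fix j assume "j \<in> {1..m}"
    then have "filterlim (\<lambda>k. g k j) cofinite sequentially" using g by (simp add: non_degenerated_def)
    from extend_growing_apart[OF this \<open>d \<ge> 1\<close>]
    show "\<exists>v. v 1 = (\<lambda>k. g k j) \<and> (\<forall>i\<in>{1..d}. filterlim (v i) cofinite sequentially) \<and>
      (\<forall>i\<in>{1..d}. \<forall>i'\<in>{1..d}. i \<noteq> i' \<longrightarrow> grow_apart (v i) (v i'))" .
  qed
  from bchoice[OF this] obtain v where v: "\<forall>j\<in>{1..m}. v j 1 = (\<lambda>k. g k j) \<and>
      (\<forall>i\<in>{1..d}. filterlim (v j i) cofinite sequentially) \<and>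
      (\<forall>i\<in>{1..d}. \<forall>i'\<in>{1..d}. i \<noteq> i' \<longrightarrow> grow_apart (v j i) (v j i'))"
    ..
  show ?thesis
  proof (rule that)
    show "v j 1 k = g k j" if "j \<in> {1..m}" for j k
      using bspec[OF v that] by simp
  qed (use v in blast)+
qed

lemma essentially_distinct_zero_extension:
  fixes g :: "nat \<Rightarrow> nat \<Rightarrow> nat \<Rightarrow> 'g"
  assumes nd: "\<And>j. j \<in> {1..l} \<Longrightarrow> non_degenerated m (g j)"
    and ed: "\<And>i j. i \<in> {1..l} \<Longrightarrow> j \<in> {1..l} \<Longrightarrow> i \<noteq> j \<Longrightarrow> essentially_distinct m (g i) (g j)"
    and ij: "i \<in> {0..l}" "j \<in> {0..l}" "i \<noteq> j"
  defines "g' \<equiv> g(0 := \<lambda>_ _. 0)"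
  shows "essentially_distinct m (g' i) (g' j)"
proof -
  consider "i = 0" "j \<in> {1..l}" | "j = 0" "i \<in> {1..l}" | "i \<in> {1..l}" "j \<in> {1..l}"
    using ij by fastforce
  then show ?thesis
  proof cases
    case 1
    then show ?thesis using nd[of j]
      by (auto simp: g'_def essentially_distinct_def non_degenerated_def intro: grow_apart_fixed)
  next
    case 2
    then show ?thesis using nd[of i]
      by (auto simp: g'_def essentially_distinct_def non_degenerated_def intro: grow_apart_fixed)
  next
    case 3
    then show ?thesis using ed ij by (simp add: g'_def)
  qed
qed

end

section \<open>Characterisations of strong mixing\<close>

theorem theorem1p21:
  fixes l :: nat
    and M :: "'x::metric_space measure"
    and T :: "'g::{ab_group_add,countable} \<Rightarrow> 'x \<Rightarrow> 'x"
  assumes "l \<ge> 1"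
    and "measure_preserving_system M T"
  defines "cond_ii \<equiv>
      (\<forall>g :: nat \<Rightarrow> nat \<Rightarrow> nat \<Rightarrow> 'g.
         (\<forall>j\<in>{1..l}. non_degenerated l (g j)) \<and>
         (\<forall>i\<in>{1..l}. \<forall>j\<in>{1..l}. i \<noteq> j \<longrightarrow> essentially_distinct l (g i) (g j)) \<longrightarrow>
         (\<exists>S :: nat set. infinite S \<and>
            (\<forall>A :: nat \<Rightarrow> 'x set. (\<forall>j\<in>{0..l}. A j \<in> sets M) \<longrightarrow>
               R_lim l S
                 (\<lambda>\<alpha>. measure M (A 0 \<inter> (\<Inter>j\<in>{1..l}. T (sum_along l (g j) \<alpha>) ` A j)))
                 (\<Prod>j=0..l. measure M (A j)))))"
    and "cond_iii \<equiv>
      (\<forall>\<epsilon>>0. \<forall>A :: nat \<Rightarrow> 'x set. (\<forall>j\<in>{0..l}. A j \<in> sets M) \<longrightarrow>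
         tilde_Sigma_star l l (R_set M T l \<epsilon> A))"
    and "cond_iv \<equiv>
      (\<forall>\<epsilon>>0. \<forall>A0\<in>sets M. \<forall>A1\<in>sets M.
         Sigma_star l {g :: 'g. \<bar>measure M (A0 \<inter> T g ` A1) - measure M A0 * measure M A1\<bar> < \<epsilon>})"
  shows "(strongly_mixing M T \<longleftrightarrow> cond_ii) \<and>
         (strongly_mixing M T \<longleftrightarrow> cond_iii) \<and>
         (strongly_mixing M T \<longleftrightarrow> cond_iv)"
proof -
  interpret measure_preserving_system M T by fact
  have iv: "strongly_mixing M T \<longleftrightarrow> cond_iv"
    unfolding cond_iv_def mixing_on_sums_iff_Sigma_star[symmetric]
    using mixing_on_sums_iff[OF \<open>l \<ge> 1\<close>] by simp

  have i_ii: cond_ii if mix: "strongly_mixing M T"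
    unfolding cond_ii_def
  proof (intro allI impI, elim conjE)
    fix g :: "nat \<Rightarrow> nat \<Rightarrow> nat \<Rightarrow> 'g"
    assume nd: "\<forall>j\<in>{1..l}. non_degenerated l (g j)"
      and ed: "\<forall>i\<in>{1..l}. \<forall>j\<in>{1..l}. i \<noteq> j \<longrightarrow> essentially_distinct l (g i) (g j)"
    define g' where "g' = g(0 := \<lambda>_ _. 0)"
    have card: "card {0..l} = Suc l" by simp
    have ed': "essentially_distinct l (g' i) (g' j)" if "i \<in> {0..l}" "j \<in> {0..l}" "i \<noteq> j" for i j
      unfolding g'_def using nd ed that by (intro essentially_distinct_zero_extension[of l]) auto
    from mixing_R_lim[OF mix finite_atLeastAtMost card \<open>l \<ge> 1\<close> ed']
    obtain S where S: "infinite S \<and> (\<forall>A. (\<forall>j\<in>{0..l}. A j \<in> sets M) \<longrightarrow>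
        R_lim l S (\<lambda>\<alpha>. measure M (\<Inter>j\<in>{0..l}. T (sum_along l (g' j) \<alpha>) ` A j)) (\<Prod>j=0..l. measure M (A j)))" ..
    have eq: "(\<Inter>j\<in>{0..l}. T (sum_along l (g' j) \<alpha>) ` A j)
        = A 0 \<inter> (\<Inter>j\<in>{1..l}. T (sum_along l (g j) \<alpha>) ` A j)"
      if "\<forall>j\<in>{0..l}. A j \<in> sets M" for A \<alpha>
    proof -
      have "A 0 \<subseteq> space M" using that by (intro sets.sets_into_space) auto
      then have "(\<Inter>j\<in>{0..l}. T (sum_along l (g' j) \<alpha>) ` A j)
          = A 0 \<inter> (\<Inter>j\<in>{1..l}. T (sum_along l (g' j) \<alpha>) ` A j)"
        by (intro INT_orbit_insert_0) (auto simp: g'_def sum_along_def)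
      then show ?thesis by (simp add: g'_def)
    qed
    show "\<exists>S. infinite S \<and> (\<forall>A. (\<forall>j\<in>{0..l}. A j \<in> sets M) \<longrightarrow>
        R_lim l S (\<lambda>\<alpha>. measure M (A 0 \<inter> (\<Inter>j\<in>{1..l}. T (sum_along l (g j) \<alpha>) ` A j)))
          (\<Prod>j=0..l. measure M (A j)))"
    proof (intro exI conjI allI impI)
      show "infinite S" using S by (rule conjunct1)
      fix A :: "nat \<Rightarrow> 'x set" assume A: "\<forall>j\<in>{0..l}. A j \<in> sets M"
      from mp[OF spec[OF conjunct2[OF S]] A]
      show "R_lim l S (\<lambda>\<alpha>. measure M (A 0 \<inter> (\<Inter>j\<in>{1..l}. T (sum_along l (g j) \<alpha>) ` A j)))
          (\<Prod>j=0..l. measure M (A j))"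
        unfolding eq[OF A] .
    qed
  qed

  have ii_i: "strongly_mixing M T" if ii: cond_ii
    unfolding mixing_on_sums_iff[OF \<open>l \<ge> 1\<close>, symmetric] mixing_on_sums_def
  proof (intro allI impI ballI)
    fix g :: "nat \<Rightarrow> nat \<Rightarrow> 'g" and A0 A1 and \<epsilon> :: real
    assume g: "non_degenerated l g" and A01: "A0 \<in> sets M" "A1 \<in> sets M" and \<epsilon>: "\<epsilon> > 0"
    obtain v where v: "\<And>j k. j \<in> {1..l} \<Longrightarrow> v j 1 k = g k j"
      "\<And>j i. j \<in> {1..l} \<Longrightarrow> i \<in> {1..l} \<Longrightarrow> filterlim (v j i) cofinite sequentially"
      "\<And>j i i'. j \<in> {1..l} \<Longrightarrow> i \<in> {1..l} \<Longrightarrow> i' \<in> {1..l} \<Longrightarrow> i \<noteq> i' \<Longrightarrow> grow_apart (v j i) (v j i')"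
      by (rule extend_to_grow_apart_family[OF g \<open>l \<ge> 1\<close>]) (rule that)
    \<comment> \<open>\<open>v t\<close> extends coordinate \<open>t\<close> of \<open>g\<close>; the sequence with index \<open>1\<close> is \<open>g\<close> itself.\<close>
    define G where "G j k t = v t j k" for j k t
    have "\<forall>j\<in>{1..l}. non_degenerated l (G j)"
      using v(2) by (simp add: non_degenerated_def G_def)
    moreover have "\<forall>i\<in>{1..l}. \<forall>j\<in>{1..l}. i \<noteq> j \<longrightarrow> essentially_distinct l (G i) (G j)"
      using v(3) by (simp add: essentially_distinct_def G_def)
    ultimately have "\<exists>S. infinite S \<and> (\<forall>A. (\<forall>j\<in>{0..l}. A j \<in> sets M) \<longrightarrow>
        R_lim l S (\<lambda>\<alpha>. measure M (A 0 \<inter> (\<Inter>j\<in>{1..l}. T (sum_along l (G j) \<alpha>) ` A j)))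
          (\<Prod>j=0..l. measure M (A j)))"
      using ii unfolding cond_ii_def by simp
    then obtain S where S: "infinite S \<and> (\<forall>A. (\<forall>j\<in>{0..l}. A j \<in> sets M) \<longrightarrow>
        R_lim l S (\<lambda>\<alpha>. measure M (A 0 \<inter> (\<Inter>j\<in>{1..l}. T (sum_along l (G j) \<alpha>) ` A j)))
          (\<Prod>j=0..l. measure M (A j)))" ..
    have G1: "sum_along l (G 1) \<alpha> = sum_along l g \<alpha>" for \<alpha>
      unfolding sum_along_def using v(1) by (intro sum.cong) (auto simp: G_def)
    note two = two_set_correlation[OF \<open>l \<ge> 1\<close> A01]
    have "R_lim l S (\<lambda>\<alpha>. measure M (A0 \<inter> T (sum_along l g \<alpha>) ` A1)) (measure M A0 * measure M A1)"
      using mp[OF spec[OF conjunct2[OF S], where x = "\<lambda>j. if j = 0 then A0 else if j = 1 then A1 else space M"]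
          ballI[OF two(1)]]
      unfolding two(2,3) G1 .
    then obtain \<alpha>0 where \<alpha>0: "\<alpha>0 \<in> nsets UNIV l" "\<forall>\<alpha>\<in>nsets S l. Max \<alpha>0 < Min \<alpha> \<longrightarrow>
        dist (measure M (A0 \<inter> T (sum_along l g \<alpha>) ` A1)) (measure M A0 * measure M A1) < \<epsilon>"
      using \<epsilon> unfolding R_lim_def by blast
    have "infinite (S - {..Max \<alpha>0})" using conjunct1[OF S] by (simp add: Diff_infinite_finite)
    then obtain \<alpha> where \<alpha>: "finite \<alpha>" "card \<alpha> = l" "\<alpha> \<subseteq> S - {..Max \<alpha>0}"
      using infinite_arbitrarily_large by blast
    then have "\<alpha> \<noteq> {}" using \<open>l \<ge> 1\<close> by auto
    then have "Min \<alpha> \<in> S - {..Max \<alpha>0}" using Min_in[OF \<alpha>(1)] \<alpha>(3) by blast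
    then have "Max \<alpha>0 < Min \<alpha>" by auto
    moreover have "\<alpha> \<in> nsets S l" using \<alpha> by (auto simp: nsets_def)
    ultimately show "\<exists>\<alpha>\<in>nsets UNIV l.
        \<bar>measure M (A0 \<inter> T (sum_along l g \<alpha>) ` A1) - measure M A0 * measure M A1\<bar> < \<epsilon>"
      using \<alpha>0(2) nsets_mono[OF subset_UNIV, of S l] by (auto simp: dist_real_def)
  qed

  have i_iii: cond_iii if mix: "strongly_mixing M T"
    unfolding cond_iii_def tilde_Sigma_star_def
  proof (intro allI impI conjI)
    fix \<epsilon> :: real and A :: "nat \<Rightarrow> 'x set" and E :: "(nat \<Rightarrow> 'g) set"
    assume \<epsilon>: "\<epsilon> > 0" and A: "\<forall>j\<in>{0..l}. A j \<in> sets M"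
    show "R_set M T l \<epsilon> A \<subseteq> group_power l" by (auto simp: R_set_def)
    assume "tilde_Sigma l l E"
    then obtain g where g: "\<forall>j\<in>{1..l}. non_degenerated l (g j) \<and>
          (\<forall>t\<in>{1..l}. \<forall>t'\<in>{1..l}. t \<noteq> t' \<longrightarrow> grow_apart (\<lambda>k. g j k t) (\<lambda>k. g j k t'))"
      and E: "E = {\<lambda>t\<in>{1..l}. \<Sum>j=1..l. g j (k j) t | k. strict_mono_on {1..l} k}"
      unfolding tilde_Sigma_def by blast
    \<comment> \<open>The coordinates \<open>t\<close> of the \<open>tilde_Sigma\<close> set become the sequences, and its summands \<open>j\<close> become their coordinates.\<close>
    define f where "f t k j = g j k t" for t k j
    define f' where "f' = f(0 := \<lambda>_ _. 0)"
    have card: "card {0..l} = Suc l" by simp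
    have ed': "essentially_distinct l (f' i) (f' j)" if "i \<in> {0..l}" "j \<in> {0..l}" "i \<noteq> j" for i j
      unfolding f'_def using g that
      by (intro essentially_distinct_zero_extension[of l])
         (auto simp: f_def non_degenerated_def essentially_distinct_def)
    have A': "A j \<in> sets M" if "j \<in> {0..l}" for j using A that by blast
    from mixing_along_sums[OF mix finite_atLeastAtMost card ed' A' \<epsilon> infinite_UNIV_nat]
    obtain \<alpha> where \<alpha>: "\<alpha> \<in> nsets UNIV l"
      "\<bar>measure M (\<Inter>j\<in>{0..l}. T (sum_along l (f' j) \<alpha>) ` A j) - (\<Prod>j=0..l. measure M (A j))\<bar> < \<epsilon>" ..
    obtain k where k: "strict_mono_on {1..l} k" "\<alpha> = k ` {1..l}"
      using \<alpha>(1) unfolding nsets_eq_strict_mono_image by auto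
    define x where "x = (\<lambda>t\<in>{1..l}. \<Sum>j=1..l. g j (k j) t)"
    have x: "x t = sum_along l (f' t) \<alpha>" if "t \<in> {1..l}" for t
      using that unfolding k(2) sum_along_strict_mono[OF k(1)] by (auto simp: x_def f'_def f_def)
    have "A 0 \<subseteq> space M" using A by (intro sets.sets_into_space) auto
    then have "(\<Inter>j\<in>{0..l}. T (sum_along l (f' j) \<alpha>) ` A j)
        = A 0 \<inter> (\<Inter>j\<in>{1..l}. T (sum_along l (f' j) \<alpha>) ` A j)"
      by (intro INT_orbit_insert_0) (auto simp: f'_def sum_along_def)
    also have "\<dots> = A 0 \<inter> (\<Inter>j\<in>{1..l}. T (x j) ` A j)" using x by simp
    finally have "x \<in> R_set M T l \<epsilon> A"
      using \<alpha>(2) by (simp add: R_set_def group_power_def x_def)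
    moreover have "x \<in> E" unfolding E x_def using k(1) by blast
    ultimately show "R_set M T l \<epsilon> A \<inter> E \<noteq> {}" by blast
  qed

  have iii_i: "strongly_mixing M T" if iii: cond_iii
    unfolding mixing_on_sums_iff[OF \<open>l \<ge> 1\<close>, symmetric] mixing_on_sums_def
  proof (intro allI impI ballI)
    fix g :: "nat \<Rightarrow> nat \<Rightarrow> 'g" and A0 A1 and \<epsilon> :: real
    assume g: "non_degenerated l g" and A01: "A0 \<in> sets M" "A1 \<in> sets M" and \<epsilon>: "\<epsilon> > 0"
    obtain v where v: "\<And>j k. j \<in> {1..l} \<Longrightarrow> v j 1 k = g k j"
      "\<And>j i. j \<in> {1..l} \<Longrightarrow> i \<in> {1..l} \<Longrightarrow> filterlim (v j i) cofinite sequentially"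
      "\<And>j i i'. j \<in> {1..l} \<Longrightarrow> i \<in> {1..l} \<Longrightarrow> i' \<in> {1..l} \<Longrightarrow> i \<noteq> i' \<Longrightarrow> grow_apart (v j i) (v j i')"
      by (rule extend_to_grow_apart_family[OF g \<open>l \<ge> 1\<close>]) (rule that)
    \<comment> \<open>\<open>v j\<close> extends the \<open>j\<close>-th summand of \<open>g\<close> to \<open>l\<close> coordinates, of which the first is that summand.\<close>
    define G where "G j k t = v j t k" for j k t
    define E where "E = {\<lambda>t\<in>{1..l}. \<Sum>j=1..l. G j (k j) t | k. strict_mono_on {1..l} k}"
    have "tilde_Sigma l l E"
      unfolding tilde_Sigma_def
    proof (intro exI[of _ G] conjI ballI impI)
      show "non_degenerated l (G j)" if "j \<in> {1..l}" for j
        using v(2) that by (simp add: non_degenerated_def G_def)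
      show "grow_apart (\<lambda>k. G j k t) (\<lambda>k. G j k t')"
        if "j \<in> {1..l}" "t \<in> {1..l}" "t' \<in> {1..l}" "t \<noteq> t'" for j t t'
        using v(3)[OF that] by (simp add: G_def)
    qed (fact E_def)
    note two = two_set_correlation[OF \<open>l \<ge> 1\<close> A01]
    define A where "A j = (if j = 0 then A0 else if j = 1 then A1 else space M)" for j :: nat
    have "\<forall>j\<in>{0..l}. A j \<in> sets M" unfolding A_def by (intro ballI two(1))
    then have "tilde_Sigma_star l l (R_set M T l \<epsilon> A)"
      using iii \<epsilon> unfolding cond_iii_def by simp
    then have "R_set M T l \<epsilon> A \<inter> E \<noteq> {}"
      using \<open>tilde_Sigma l l E\<close> by (simp add: tilde_Sigma_star_def)
    then obtain x where x: "x \<in> R_set M T l \<epsilon> A" "x \<in> E" by blast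
    then obtain k where k: "strict_mono_on {1..l} k" "x = (\<lambda>t\<in>{1..l}. \<Sum>j=1..l. G j (k j) t)"
      unfolding E_def by blast
    have "x 1 = (\<Sum>j=1..l. g (k j) j)"
      using \<open>l \<ge> 1\<close> v(1) unfolding k(2) by (auto simp: G_def intro!: sum.cong)
    then have "x 1 = sum_along l g (k ` {1..l})" by (simp only: sum_along_strict_mono[OF k(1)])
    moreover have "\<bar>measure M (A0 \<inter> T (x 1) ` A1) - measure M A0 * measure M A1\<bar> < \<epsilon>"
      using x(1) two(2)[of x] two(3) unfolding R_set_def A_def[abs_def] by simp
    moreover have "k ` {1..l} \<in> nsets UNIV l" unfolding nsets_eq_strict_mono_image using k(1) by blast
    ultimately show "\<exists>\<alpha>\<in>nsets UNIV l.
        \<bar>measure M (A0 \<inter> T (sum_along l g \<alpha>) ` A1) - measure M A0 * measure M A1\<bar> < \<epsilon>"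
      by (intro bexI[of _ "k ` {1..l}"]) simp_all
  qed

  show ?thesis using i_ii ii_i i_iii iii_i iv by blast
qed

end
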